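(* Let $\mathrm{I}$ be a set, let $\mathbf{G}:\mathbf{Gl}(\mathrm{I})\to\mathbf{Top}^{\mathrm{op}}$ be a $\mathbf{Top}^{\mathrm{op}}$-gluing data functor of type $\mathrm{I}$, let $Q$ be a topological space, and let $\iota_Q^{\mathrm{op}}=\{\iota_{Q,a}^{\mathrm{op}}\}_{a\in\mathrm{Ob}(\mathbf{Gl}(\mathrm{I}))}$ be a family where $\iota_{Q,a}:\mathbf{G}(a)\to Q$ is a morphism of $\mathbf{Top}$ for every object $a$ of $\mathbf{Gl}(\mathrm{I})$. The following assertions are equivalent: (1) $Q$ is a glued-up $\mathbf{Top}^{\mathrm{op}}$-object along $\mathbf{G}$ through $\iota_Q^{\mathrm{op}}$; (2) $(Q,\iota_Q^{\mathrm{op}})$ is a cone over $\mathbf{G}$ isomorphic to the standard representative $(Q_{\mathbf{G}},\iota_{Q_{\mathbf{G}}}^{\mathrm{op}})$ in the category of cones over $\mathbf{G}$; (3) for all $i,j,k\in\mathrm{I}$ and $n\in\{j,k\}$: (a) $\iota_{Q,[i,j]}=\iota_{Q,i}\circ\mathbf{G}(\eta_{i,[i,j]})^{\mathrm{op}}$; (b) $\iota_{Q,[i,j,k]}=\iota_{Q,[i,n]}\circ\mathbf{G}(\eta_{[i,n],[i,j,k]})^{\mathrm{op}}$; (c) $\iota_{Q,i}\circ\mathbf{G}(\eta_{i,[i,j]})^{\mathrm{op}}=\iota_{Q,j}\circ\mathbf{G}(\eta_{j,[j,i]})^{\mathrm{op}}\circ\mathbf{G}(\tau_{[i,j]})^{\mathrm{op}}$;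 (d) $Q=\bigcup_{i\in\mathrm{I}}\iota_{Q,i}(\mathbf{G}(i))$; (e) $\iota_{Q,j}\big(\mathbf{G}(\eta_{j,[j,i]})^{\mathrm{op}}(\mathbf{G}(j,i))\big)=\iota_{Q,i}\big(\mathbf{G}(\eta_{i,[i,j]})^{\mathrm{op}}(\mathbf{G}(i,j))\big)=\iota_{Q,i}(\mathbf{G}(i))\cap\iota_{Q,j}(\mathbf{G}(j))$; (f) $\iota_{Q,i}$ is a one-to-one continuous map.
   Context: $\mathbf{Top}$ is the category of topological spaces and continuous maps; for a morphism $f$ of $\mathbf{Top}^{\mathrm{op}}$, $f^{\mathrm{op}}$ denotes the corresponding continuous map in $\mathbf{Top}$ (and conversely). Gluing index category. For a set $\mathrm{I}$, the category $\mathbf{Gl}(\mathrm{I})$ has as objects the equivalence classes of elements of $\mathrm{I}\cup\mathrm{I}^2\cup\mathrm{I}^3$ under the equivalence relation generated by $i\sim(i,i)$, $(i,j,k)\sim(i,k,j)$ and $(i,j,j)\sim(i,j)$; the classes of $i$, $(i,j)$, $(i,j,k)$ are written $[i]$ (or simply $i$), $[i,j]$, $[i,j,k]$. There is at most one morphism between any two objects. The morphisms are the identities, the morphisms $\eta_{i,[i,j]}:i\to[i,j]$, $\tau_{[i,j]}:[j,i]\to[i,j]$, $\eta_{[i,n],[i,j,k]}:[i,n]\to[i,j,k]$ for $n\in\{j,k\}$, $\tau_{k,[i,j]}:[j,i,k]\to[i,j,k]$ (for all $i,j,k\in\mathrm{I}$), and their composites. In $\mathbf{Gl}(\mathrm{I})$,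 $[i,j,k]$ is the pushout of $[i,j]$ and $[i,k]$ over $i$. The unique morphism $i\to[i,j,k]$ is denoted $\eta_{i,[i,j,k]}$. Gluing data functor. A $\mathbf{C}$-gluing data functor of type $\mathrm{I}$ is a functor $\mathbf{G}:\mathbf{Gl}(\mathrm{I})\to\mathbf{C}$ sending, for all $i,j,k\in\mathrm{I}$, the pushout $[i,j,k]$ to the corresponding pushout in $\mathbf{C}$ (of $\mathbf{G}([i,j])$ and $\mathbf{G}([i,k])$ over $\mathbf{G}([i])$), the image of $\eta_{[i,n],[i,j,k]}$, $n\in\{j,k\}$, being the canonical morphism into that pushout. (For $\mathbf{C}=\mathbf{Top}^{\mathrm{op}}$ these pushouts are pullbacks in $\mathbf{Top}$.) Write $\mathbf{G}(i)=\mathbf{G}([i])$, $\mathbf{G}(i,j)=\mathbf{G}([i,j])$, $\mathbf{G}(i,j,k)=\mathbf{G}([i,j,k])$. Glued-up object. $L$ is a glued-up $\mathbf{C}$-object along $\mathbf{G}$ through $\pi_L=\{\pi_{L,a}:L\to\mathbf{G}(a)\}_a$ if the limit of $\mathbf{G}$ exists and $(L,\pi_L)$ is a cone over $\mathbf{G}$ isomorphic (as a cone) to $\lim\mathbf{G}$. Standard representative. $Q_{\mathbf{G}}=\big(\coprod_{i\in\mathrm{I}}\mathbf{G}(i)\big)/\mathcal{R}_{\mathbf{G}}$, where $\mathcal{R}_{\mathbf{G}}$ is the equivalence relation given by: $(x,i)\,\mathcal{R}_{\mathbf{G}}\,(y,j)$ iff there is $u\in\mathbf{G}(i,j)$ with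 $x=\mathbf{G}(\eta_{i,[i,j]})^{\mathrm{op}}(u)$ and $y=\mathbf{G}(\eta_{j,[j,i]})^{\mathrm{op}}\circ\mathbf{G}(\tau_{[i,j]})^{\mathrm{op}}(u)$. With $\pi$ the quotient map, the family $\iota_{Q_{\mathbf{G}}}$ consists of $\iota_{Q_{\mathbf{G}},i}:\mathbf{G}(i)\to Q_{\mathbf{G}}$, $x\mapsto\pi(x,i)$; $\iota_{Q_{\mathbf{G}},[i,j]}=\iota_{Q_{\mathbf{G}},i}\circ\mathbf{G}(\eta_{i,[i,j]})^{\mathrm{op}}$; and $\iota_{Q_{\mathbf{G}},[i,j,k]}=\iota_{Q_{\mathbf{G}},i}\circ\mathbf{G}(\eta_{i,[i,j,k]})^{\mathrm{op}}$. The space $Q_{\mathbf{G}}$ carries the final topology with respect to the maps $\iota_{Q_{\mathbf{G}},i}$, $i\in\mathrm{I}$.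
   Formalization: Condition (3) also requires that Q carry the final topology for the maps ι_{Q,i}; without it (3)⇒(1) fails (two points glued along the empty set, Q indiscrete). Top means all spaces with points in an arbitrary fixed universe having at least two points. *)

theory Defs
  imports "HOL-Analysis.Abstract_Topology" "HOL-Library.FuncSet"
begin

section \<open>Categories, functors, pushouts, cones and limits\<close>

text \<open>Morphisms are typed by their hom-sets, so composition takes the three objects involved:
  \<open>Cmp C x y z g f\<close> is the composite of \<open>f : x \<rightarrow> y\<close> and \<open>g : y \<rightarrow> z\<close>.\<close>

record ('o, 'm) cat =
  Ob :: "'o set"
  Hom :: "'o \<Rightarrow> 'o \<Rightarrow> 'm set"
  Ide :: "'o \<Rightarrow> 'm"
  Cmp :: "'o \<Rightarrow> 'o \<Rightarrow> 'o \<Rightarrow> 'm \<Rightarrow> 'm \<Rightarrow> 'm"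

definition is_category :: "('o, 'm) cat \<Rightarrow> bool" where
  "is_category C \<longleftrightarrow>
     (\<forall>x\<in>Ob C. Ide C x \<in> Hom C x x) \<and>
     (\<forall>x\<in>Ob C. \<forall>y\<in>Ob C. \<forall>z\<in>Ob C. \<forall>f\<in>Hom C x y. \<forall>g\<in>Hom C y z. Cmp C x y z g f \<in> Hom C x z) \<and>
     (\<forall>x\<in>Ob C. \<forall>y\<in>Ob C. \<forall>f\<in>Hom C x y. Cmp C x x y f (Ide C x) = f \<and> Cmp C x y y (Ide C y) f = f) \<and>
     (\<forall>w\<in>Ob C. \<forall>x\<in>Ob C. \<forall>y\<in>Ob C. \<forall>z\<in>Ob C. \<forall>f\<in>Hom C w x. \<forall>g\<in>Hom C x y. \<forall>h\<in>Hom C y z.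
        Cmp C w x z (Cmp C x y z h g) f = Cmp C w y z h (Cmp C w x y g f))"

definition dual :: "('o, 'm) cat \<Rightarrow> ('o, 'm) cat" where
  "dual C = \<lparr> Ob = Ob C, Hom = (\<lambda>x y. Hom C y x), Ide = Ide C,
              Cmp = (\<lambda>x y z g f. Cmp C z y x f g) \<rparr>"

record ('o, 'm, 'p, 'n) ftor =
  OMap :: "'o \<Rightarrow> 'p"
  AMap :: "'o \<Rightarrow> 'o \<Rightarrow> 'm \<Rightarrow> 'n"

definition is_functor :: "('o, 'm) cat \<Rightarrow> ('p, 'n) cat \<Rightarrow> ('o, 'm, 'p, 'n) ftor \<Rightarrow> bool" where
  "is_functor J C F \<longleftrightarrow>
     (\<forall>a\<in>Ob J. OMap F a \<in> Ob C) \<and>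
     (\<forall>a\<in>Ob J. \<forall>b\<in>Ob J. \<forall>f\<in>Hom J a b. AMap F a b f \<in> Hom C (OMap F a) (OMap F b)) \<and>
     (\<forall>a\<in>Ob J. AMap F a a (Ide J a) = Ide C (OMap F a)) \<and>
     (\<forall>a\<in>Ob J. \<forall>b\<in>Ob J. \<forall>c\<in>Ob J. \<forall>f\<in>Hom J a b. \<forall>g\<in>Hom J b c.
        AMap F a c (Cmp J a b c g f) =
          Cmp C (OMap F a) (OMap F b) (OMap F c) (AMap F b c g) (AMap F a b f))"

text \<open>\<open>p\<close> with \<open>u : y \<rightarrow> p\<close> and \<open>v : z \<rightarrow> p\<close> is a pushout of \<open>f : x \<rightarrow> y\<close> and \<open>g : x \<rightarrow> z\<close>.\<close>

definition is_pushout ::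
  "('o, 'm) cat \<Rightarrow> 'o \<Rightarrow> 'o \<Rightarrow> 'o \<Rightarrow> 'm \<Rightarrow> 'm \<Rightarrow> 'o \<Rightarrow> 'm \<Rightarrow> 'm \<Rightarrow> bool" where
  "is_pushout C x y z f g p u v \<longleftrightarrow>
     x \<in> Ob C \<and> y \<in> Ob C \<and> z \<in> Ob C \<and> p \<in> Ob C \<and>
     f \<in> Hom C x y \<and> g \<in> Hom C x z \<and> u \<in> Hom C y p \<and> v \<in> Hom C z p \<and>
     Cmp C x y p u f = Cmp C x z p v g \<and>
     (\<forall>q\<in>Ob C. \<forall>s\<in>Hom C y q. \<forall>t\<in>Hom C z q. Cmp C x y q s f = Cmp C x z q t g \<longrightarrow>
        (\<exists>!m. m \<in> Hom C p q \<and> Cmp C y p q m u = s \<and> Cmp C z p q m v = t))"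

definition cone_over ::
  "('p, 'n) cat \<Rightarrow> ('o, 'm) cat \<Rightarrow> ('o, 'm, 'p, 'n) ftor \<Rightarrow> 'p \<Rightarrow> ('o \<Rightarrow> 'n) \<Rightarrow> bool" where
  "cone_over C J F L \<pi> \<longleftrightarrow>
     L \<in> Ob C \<and>
     (\<forall>a\<in>Ob J. \<pi> a \<in> Hom C L (OMap F a)) \<and>
     (\<forall>a\<in>Ob J. \<forall>b\<in>Ob J. \<forall>f\<in>Hom J a b.
        Cmp C L (OMap F a) (OMap F b) (AMap F a b f) (\<pi> a) = \<pi> b)"

definition cone_mor ::
  "('p, 'n) cat \<Rightarrow> ('o, 'm) cat \<Rightarrow> ('o, 'm, 'p, 'n) ftor \<Rightarrow>
   'p \<Rightarrow> ('o \<Rightarrow> 'n) \<Rightarrow> 'p \<Rightarrow> ('o \<Rightarrow> 'n) \<Rightarrow> 'n \<Rightarrow> bool" where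
  "cone_mor C J F L \<pi> M \<mu> h \<longleftrightarrow>
     h \<in> Hom C L M \<and> (\<forall>a\<in>Ob J. Cmp C L M (OMap F a) (\<mu> a) h = \<pi> a)"

definition cone_iso ::
  "('p, 'n) cat \<Rightarrow> ('o, 'm) cat \<Rightarrow> ('o, 'm, 'p, 'n) ftor \<Rightarrow>
   'p \<Rightarrow> ('o \<Rightarrow> 'n) \<Rightarrow> 'p \<Rightarrow> ('o \<Rightarrow> 'n) \<Rightarrow> bool" where
  "cone_iso C J F L \<pi> M \<mu> \<longleftrightarrow>
     (\<exists>h k. cone_mor C J F L \<pi> M \<mu> h \<and> cone_mor C J F M \<mu> L \<pi> k \<and>
            Cmp C L M L k h = Ide C L \<and> Cmp C M L M h k = Ide C M)"

definition is_limit ::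
  "('p, 'n) cat \<Rightarrow> ('o, 'm) cat \<Rightarrow> ('o, 'm, 'p, 'n) ftor \<Rightarrow> 'p \<Rightarrow> ('o \<Rightarrow> 'n) \<Rightarrow> bool" where
  "is_limit C J F M \<mu> \<longleftrightarrow>
     cone_over C J F M \<mu> \<and>
     (\<forall>L \<pi>. cone_over C J F L \<pi> \<longrightarrow> (\<exists>!h. cone_mor C J F L \<pi> M \<mu> h))"

lemma is_category_dual: "is_category C \<Longrightarrow> is_category (dual C)"
  unfolding is_category_def dual_def by simp

section \<open>The category of topological spaces\<close>

text \<open>The type \<open>'u\<close> of points plays the role of the universe: the objects are all topological
  spaces whose points belong to \<open>'u\<close>.  Given data can be moved to an arbitrarily large \<open>'u\<close>; a
  universe of a single point is too poor, since a limit in the dual of its category need not be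
  the expected quotient space.  Morphisms are continuous maps, made undefined outside the source
  space so that equal morphisms are equal as functions.\<close>

definition TopCat :: "('u topology, 'u \<Rightarrow> 'u) cat" where
  "TopCat = \<lparr> Ob = UNIV,
              Hom = (\<lambda>X Y. {f \<in> extensional (topspace X). continuous_map X Y f}),
              Ide = (\<lambda>X. \<lambda>x\<in>topspace X. x),
              Cmp = (\<lambda>X Y Z g f. compose (topspace X) g f) \<rparr>"

lemma is_category_TopCat: "is_category TopCat"
  unfolding is_category_def TopCat_def
  apply (auto simp: compose_def)
  subgoal for x y z f g using continuous_map_compose[of x y f z g] by (simp add: o_def)
  subgoal for x y f by (force simp: extensional_def)
  subgoal for x y f by (fastforce simp: extensional_def fun_eq_iff dest: continuous_map_funspace)
  subgoal for w x y z f g h by (fastforce simp: fun_eq_iff dest: continuous_map_funspace)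
  done

section \<open>The gluing index category\<close>

datatype 'i gl_word = W1 'i | W2 'i 'i | W3 'i 'i 'i

type_synonym 'i gl_obj = "'i gl_word set"

fun gl_letters :: "'i gl_word \<Rightarrow> 'i set" where
  "gl_letters (W1 i) = {i}"
| "gl_letters (W2 i j) = {i, j}"
| "gl_letters (W3 i j k) = {i, j, k}"

definition gl_words :: "'i set \<Rightarrow> 'i gl_word set" where
  "gl_words I = {w. gl_letters w \<subseteq> I}"

inductive_set gl_eqv :: "'i set \<Rightarrow> ('i gl_word \<times> 'i gl_word) set" for I :: "'i set" where
  one: "i \<in> I \<Longrightarrow> (W1 i, W2 i i) \<in> gl_eqv I"
| swap: "i \<in> I \<Longrightarrow> j \<in> I \<Longrightarrow> k \<in> I \<Longrightarrow> (W3 i j k, W3 i k j) \<in> gl_eqv I"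
| diag: "i \<in> I \<Longrightarrow> j \<in> I \<Longrightarrow> (W3 i j j, W2 i j) \<in> gl_eqv I"
| refl: "w \<in> gl_words I \<Longrightarrow> (w, w) \<in> gl_eqv I"
| sym: "(v, w) \<in> gl_eqv I \<Longrightarrow> (w, v) \<in> gl_eqv I"
| trans: "(u, v) \<in> gl_eqv I \<Longrightarrow> (v, w) \<in> gl_eqv I \<Longrightarrow> (u, w) \<in> gl_eqv I"

definition ob1 :: "'i set \<Rightarrow> 'i \<Rightarrow> 'i gl_obj" where
  "ob1 I i = gl_eqv I `` {W1 i}"

definition ob2 :: "'i set \<Rightarrow> 'i \<Rightarrow> 'i \<Rightarrow> 'i gl_obj" where
  "ob2 I i j = gl_eqv I `` {W2 i j}"

definition ob3 :: "'i set \<Rightarrow> 'i \<Rightarrow> 'i \<Rightarrow> 'i \<Rightarrow> 'i gl_obj" where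
  "ob3 I i j k = gl_eqv I `` {W3 i j k}"

inductive gl_arrow :: "'i set \<Rightarrow> 'i gl_obj \<Rightarrow> 'i gl_obj \<Rightarrow> bool" for I :: "'i set" where
  ide: "a \<in> gl_words I // gl_eqv I \<Longrightarrow> gl_arrow I a a"
| eta1: "i \<in> I \<Longrightarrow> j \<in> I \<Longrightarrow> gl_arrow I (ob1 I i) (ob2 I i j)"
| tau2: "i \<in> I \<Longrightarrow> j \<in> I \<Longrightarrow> gl_arrow I (ob2 I j i) (ob2 I i j)"
| eta2: "i \<in> I \<Longrightarrow> j \<in> I \<Longrightarrow> k \<in> I \<Longrightarrow> n \<in> {j, k} \<Longrightarrow> gl_arrow I (ob2 I i n) (ob3 I i j k)"
| tau3: "i \<in> I \<Longrightarrow> j \<in> I \<Longrightarrow> k \<in> I \<Longrightarrow> gl_arrow I (ob3 I j i k) (ob3 I i j k)"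
| comp: "gl_arrow I a b \<Longrightarrow> gl_arrow I b c \<Longrightarrow> gl_arrow I a c"

text \<open>There is at most one morphism between two objects, so a hom-set is \<open>{()}\<close> or empty.\<close>

definition Gl :: "'i set \<Rightarrow> ('i gl_obj, unit) cat" where
  "Gl I = \<lparr> Ob = gl_words I // gl_eqv I,
            Hom = (\<lambda>a b. if gl_arrow I a b then {()} else {}),
            Ide = (\<lambda>a. ()),
            Cmp = (\<lambda>a b c g f. ()) \<rparr>"

lemma is_category_Gl: "is_category (Gl I)"
  unfolding is_category_def Gl_def by (auto intro: gl_arrow.intros split: if_splits)

text \<open>The image of the unique morphism \<open>a \<rightarrow> b\<close> under a functor on \<open>Gl I\<close>.\<close>

abbreviation garr :: "('i gl_obj, unit, 'p, 'n) ftor \<Rightarrow> 'i gl_obj \<Rightarrow> 'i gl_obj \<Rightarrow> 'n" where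
  "garr G a b \<equiv> AMap G a b ()"

section \<open>Gluing data functors and glued-up objects\<close>

definition gluing_data_functor ::
  "('p, 'n) cat \<Rightarrow> 'i set \<Rightarrow> ('i gl_obj, unit, 'p, 'n) ftor \<Rightarrow> bool" where
  "gluing_data_functor C I G \<longleftrightarrow>
     is_functor (Gl I) C G \<and>
     (\<forall>i\<in>I. \<forall>j\<in>I. \<forall>k\<in>I.
        is_pushout C (OMap G (ob1 I i)) (OMap G (ob2 I i j)) (OMap G (ob2 I i k))
          (garr G (ob1 I i) (ob2 I i j)) (garr G (ob1 I i) (ob2 I i k))
          (OMap G (ob3 I i j k))
          (garr G (ob2 I i j) (ob3 I i j k)) (garr G (ob2 I i k) (ob3 I i j k)))"

definition glued_up ::
  "('p, 'n) cat \<Rightarrow> 'i set \<Rightarrow> ('i gl_obj, unit, 'p, 'n) ftor \<Rightarrow> 'p \<Rightarrow> ('i gl_obj \<Rightarrow> 'n) \<Rightarrow> bool" where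
  "glued_up C I G L \<pi> \<longleftrightarrow>
     cone_over C (Gl I) G L \<pi> \<and>
     (\<exists>M \<mu>. is_limit C (Gl I) G M \<mu> \<and> cone_iso C (Gl I) G L \<pi> M \<mu>)"

section \<open>The standard representative\<close>

text \<open>A functor to \<open>dual TopCat\<close> sends the morphism \<open>a \<rightarrow> b\<close> to a continuous map from
  \<open>OMap G b\<close> to \<open>OMap G a\<close>; passing to the opposite morphism is not visible in the notation.\<close>

type_synonym ('i, 'u) top_ftor = "('i gl_obj, unit, 'u topology, 'u \<Rightarrow> 'u) ftor"

text \<open>A glued-up space carries the final topology with respect to the maps \<open>\<iota>\<^sub>i\<close>.  This does not
  follow from the set-theoretic conditions on a jointly surjective family of injective continuous
  maps: two points glued along the empty set satisfy all of them for the indiscrete topology,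
  whereas the glued-up space is discrete.\<close>

definition final_topology ::
  "'q set \<Rightarrow> 'i set \<Rightarrow> ('i \<Rightarrow> 'x topology) \<Rightarrow> ('i \<Rightarrow> 'x \<Rightarrow> 'q) \<Rightarrow> 'q topology" where
  "final_topology S I X f =
     topology (\<lambda>U. U \<subseteq> S \<and> (\<forall>i\<in>I. openin (X i) {x \<in> topspace (X i). f i x \<in> U}))"

lemma openin_final_topology:
  "openin (final_topology S I X f) U \<longleftrightarrow>
     U \<subseteq> S \<and> (\<forall>i\<in>I. openin (X i) {x \<in> topspace (X i). f i x \<in> U})"
proof -
  have "istopology (\<lambda>U. U \<subseteq> S \<and> (\<forall>i\<in>I. openin (X i) {x \<in> topspace (X i). f i x \<in> U}))"
    unfolding istopology_def
  proof (intro conjI allI impI ballI)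
    fix U V i
    assume "U \<subseteq> S \<and> (\<forall>i\<in>I. openin (X i) {x \<in> topspace (X i). f i x \<in> U})"
      "V \<subseteq> S \<and> (\<forall>i\<in>I. openin (X i) {x \<in> topspace (X i). f i x \<in> V})" "i \<in> I"
    then have "openin (X i) ({x \<in> topspace (X i). f i x \<in> U} \<inter> {x \<in> topspace (X i). f i x \<in> V})"
      by (intro openin_Int) auto
    moreover have "{x \<in> topspace (X i). f i x \<in> U} \<inter> {x \<in> topspace (X i). f i x \<in> V}
        = {x \<in> topspace (X i). f i x \<in> U \<inter> V}" by auto
    ultimately show "openin (X i) {x \<in> topspace (X i). f i x \<in> U \<inter> V}" by simp
  next
    fix K i
    assume "\<forall>U\<in>K. U \<subseteq> S \<and> (\<forall>i\<in>I. openin (X i) {x \<in> topspace (X i). f i x \<in> U})" "i \<in> I"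
    then have "openin (X i) (\<Union>U\<in>K. {x \<in> topspace (X i). f i x \<in> U})"
      by (intro openin_Union) auto
    moreover have "(\<Union>U\<in>K. {x \<in> topspace (X i). f i x \<in> U}) = {x \<in> topspace (X i). f i x \<in> \<Union>K}"
      by auto
    ultimately show "openin (X i) {x \<in> topspace (X i). f i x \<in> \<Union>K}" by simp
  qed auto
  then show ?thesis by (simp add: final_topology_def topology_inverse')
qed

definition glue_sum :: "'i set \<Rightarrow> ('i, 'u) top_ftor \<Rightarrow> ('u \<times> 'i) set" where
  "glue_sum I G = {(x, i). i \<in> I \<and> x \<in> topspace (OMap G (ob1 I i))}"

definition glue_rel :: "'i set \<Rightarrow> ('i, 'u) top_ftor \<Rightarrow> (('u \<times> 'i) \<times> ('u \<times> 'i)) set" where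
  "glue_rel I G = {((x, i), (y, j)). i \<in> I \<and> j \<in> I \<and>
     (\<exists>u\<in>topspace (OMap G (ob2 I i j)).
        x = garr G (ob1 I i) (ob2 I i j) u \<and>
        y = garr G (ob1 I j) (ob2 I j i) (garr G (ob2 I j i) (ob2 I i j) u))}"

definition glue_proj :: "'i set \<Rightarrow> ('i, 'u) top_ftor \<Rightarrow> 'u \<times> 'i \<Rightarrow> ('u \<times> 'i) set" where
  "glue_proj I G p = glue_rel I G `` {p}"

definition std_space :: "'i set \<Rightarrow> ('i, 'u) top_ftor \<Rightarrow> ('u \<times> 'i) set topology" where
  "std_space I G =
     final_topology (glue_sum I G // glue_rel I G) I
       (\<lambda>i. OMap G (ob1 I i)) (\<lambda>i x. glue_proj I G (x, i))"

text \<open>The generating relations of \<open>gl_eqv\<close> preserve the first letter, so all words in an object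
  share their first letter \<open>i\<close>.  The map \<open>std_inj I G a\<close> is uniformly \<open>\<iota>\<^sub>i\<close> composed with the image of
  \<open>i \<rightarrow> a\<close>; for \<open>a = [i]\<close> the latter is an identity.\<close>

fun gl_first :: "'i gl_word \<Rightarrow> 'i" where
  "gl_first (W1 i) = i"
| "gl_first (W2 i j) = i"
| "gl_first (W3 i j k) = i"

definition ob_first :: "'i gl_obj \<Rightarrow> 'i" where
  "ob_first a = (THE i. gl_first ` a = {i})"

definition std_inj :: "'i set \<Rightarrow> ('i, 'u) top_ftor \<Rightarrow> 'i gl_obj \<Rightarrow> 'u \<Rightarrow> ('u \<times> 'i) set" where
  "std_inj I G a x = glue_proj I G (garr G (ob1 I (ob_first a)) a x, ob_first a)"

lemma gl_eqv_first: "(v, w) \<in> gl_eqv I \<Longrightarrow> gl_first v = gl_first w"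
  by (induction rule: gl_eqv.induct) auto

lemma ob_first_class: "w \<in> gl_words I \<Longrightarrow> ob_first (gl_eqv I `` {w}) = gl_first w"
proof -
  assume w: "w \<in> gl_words I"
  have "gl_first ` (gl_eqv I `` {w}) = {gl_first w}"
    using gl_eqv.refl[OF w] by (force dest: gl_eqv_first)
  then show ?thesis by (simp add: ob_first_def)
qed

lemma ob_first_simps:
  "i \<in> I \<Longrightarrow> ob_first (ob1 I i) = i"
  "i \<in> I \<Longrightarrow> j \<in> I \<Longrightarrow> ob_first (ob2 I i j) = i"
  "i \<in> I \<Longrightarrow> j \<in> I \<Longrightarrow> k \<in> I \<Longrightarrow> ob_first (ob3 I i j k) = i"
  by (simp_all add: ob1_def ob2_def ob3_def ob_first_class gl_words_def)

lemma gl_ob: "i \<in> I \<Longrightarrow> ob1 I i \<in> Ob (Gl I)"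
  "i \<in> I \<Longrightarrow> j \<in> I \<Longrightarrow> ob2 I i j \<in> Ob (Gl I)"
  "i \<in> I \<Longrightarrow> j \<in> I \<Longrightarrow> k \<in> I \<Longrightarrow> ob3 I i j k \<in> Ob (Gl I)"
  by (auto simp: Gl_def ob1_def ob2_def ob3_def gl_words_def intro!: quotientI)

lemma std_inj_ob1:
  assumes "is_functor (Gl I) (dual TopCat) G" "i \<in> I" "x \<in> topspace (OMap G (ob1 I i))"
  shows "std_inj I G (ob1 I i) x = glue_proj I G (x, i)"
proof -
  have "garr G (ob1 I i) (ob1 I i) = Ide (dual TopCat) (OMap G (ob1 I i))"
    using assms(1) gl_ob(1)[OF assms(2)] unfolding is_functor_def by (simp add: Gl_def)
  then show ?thesis
    using assms by (simp add: std_inj_def ob_first_simps dual_def TopCat_def)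
qed

lemma std_inj_ob2:
  assumes "is_functor (Gl I) (dual TopCat) G" "i \<in> I" "j \<in> I" "x \<in> topspace (OMap G (ob2 I i j))"
  shows "std_inj I G (ob2 I i j) x = std_inj I G (ob1 I i) (garr G (ob1 I i) (ob2 I i j) x)"
proof -
  have "garr G (ob1 I i) (ob2 I i j) \<in> Hom (dual TopCat) (OMap G (ob1 I i)) (OMap G (ob2 I i j))"
    using assms(1) gl_ob[of _ I] gl_arrow.eta1[OF assms(2,3)] assms(2,3)
    unfolding is_functor_def by (fastforce simp: Gl_def)
  then have "garr G (ob1 I i) (ob2 I i j) x \<in> topspace (OMap G (ob1 I i))"
    using assms(4) by (auto simp: dual_def TopCat_def dest: continuous_map_funspace)
  then show ?thesis
    using assms by (simp add: std_inj_ob1) (simp add: std_inj_def ob_first_simps)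
qed

text \<open>The points of \<open>std_space I G\<close> have a type of their own.  Isomorphism of cones over \<open>G\<close> in
  \<open>dual TopCat\<close> is therefore stated for apexes over two types of points; for equal types it is
  the general \<open>cone_iso\<close>, as the lemma below shows.\<close>

definition top_cone_iso ::
  "'i set \<Rightarrow> ('i, 'u) top_ftor \<Rightarrow> 'a topology \<Rightarrow> ('i gl_obj \<Rightarrow> 'u \<Rightarrow> 'a) \<Rightarrow>
   'b topology \<Rightarrow> ('i gl_obj \<Rightarrow> 'u \<Rightarrow> 'b) \<Rightarrow> bool" where
  "top_cone_iso I G L \<pi> M \<mu> \<longleftrightarrow>
     (\<exists>h k. homeomorphic_maps L M h k \<and>
        (\<forall>a\<in>Ob (Gl I). \<forall>x\<in>topspace (OMap G a). h (\<pi> a x) = \<mu> a x \<and> k (\<mu> a x) = \<pi> a x))"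

lemma cone_iso_eq_top_cone_iso:
  assumes L: "\<And>a. a \<in> Ob (Gl I) \<Longrightarrow> \<pi> a \<in> Hom TopCat (OMap G a) L"
    and M: "\<And>a. a \<in> Ob (Gl I) \<Longrightarrow> \<mu> a \<in> Hom TopCat (OMap G a) M"
  shows "cone_iso (dual TopCat) (Gl I) G L \<pi> M \<mu> \<longleftrightarrow> top_cone_iso I G L \<pi> M \<mu>"
proof
  assume "cone_iso (dual TopCat) (Gl I) G L \<pi> M \<mu>"
  then obtain h k where
    hk: "h \<in> Hom TopCat M L" "k \<in> Hom TopCat L M"
      "compose (topspace L) h k = (\<lambda>x\<in>topspace L. x)"
      "compose (topspace M) k h = (\<lambda>x\<in>topspace M. x)"
      "\<And>a. a \<in> Ob (Gl I) \<Longrightarrow> compose (topspace (OMap G a)) h (\<mu> a) = \<pi> a"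
      "\<And>a. a \<in> Ob (Gl I) \<Longrightarrow> compose (topspace (OMap G a)) k (\<pi> a) = \<mu> a"
    unfolding cone_iso_def cone_mor_def dual_def by (auto simp: TopCat_def)
  have "homeomorphic_maps L M k h"
    using hk(1,2) fun_cong[OF hk(3)] fun_cong[OF hk(4)]
    by (auto simp: homeomorphic_maps_def TopCat_def compose_def restrict_def split: if_splits)
      metis+
  moreover have "k (\<pi> a x) = \<mu> a x \<and> h (\<mu> a x) = \<pi> a x"
    if "a \<in> Ob (Gl I)" "x \<in> topspace (OMap G a)" for a x
    using fun_cong[OF hk(5)[OF that(1)], of x] fun_cong[OF hk(6)[OF that(1)], of x] that(2)
    by (simp add: compose_def)
  ultimately show "top_cone_iso I G L \<pi> M \<mu>" unfolding top_cone_iso_def by blast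
next
  assume "top_cone_iso I G L \<pi> M \<mu>"
  then obtain h k where hk: "homeomorphic_maps L M h k"
    "\<And>a x. a \<in> Ob (Gl I) \<Longrightarrow> x \<in> topspace (OMap G a) \<Longrightarrow> h (\<pi> a x) = \<mu> a x \<and> k (\<mu> a x) = \<pi> a x"
    unfolding top_cone_iso_def by blast
  define h' where "h' = restrict h (topspace L)"
  define k' where "k' = restrict k (topspace M)"
  have cont: "continuous_map L M h" "continuous_map M L k"
    and inv: "\<And>x. x \<in> topspace L \<Longrightarrow> k (h x) = x" "\<And>x. x \<in> topspace M \<Longrightarrow> h (k x) = x"
    using hk(1) by (auto simp: homeomorphic_maps_def)
  have mem: "\<And>x. x \<in> topspace L \<Longrightarrow> h x \<in> topspace M" "\<And>x. x \<in> topspace M \<Longrightarrow> k x \<in> topspace L"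
    using cont by (auto dest: continuous_map_funspace)
  have "h' \<in> Hom TopCat L M"
    using continuous_map_eq[OF cont(1), of h'] by (auto simp: TopCat_def h'_def)
  moreover have "k' \<in> Hom TopCat M L"
    using continuous_map_eq[OF cont(2), of k'] by (auto simp: TopCat_def k'_def)
  moreover have "compose (topspace L) k' h' = (\<lambda>x\<in>topspace L. x)"
    "compose (topspace M) h' k' = (\<lambda>x\<in>topspace M. x)"
    using mem inv by (auto simp: compose_def h'_def k'_def restrict_def fun_eq_iff)
  moreover have "compose (topspace (OMap G a)) k' (\<mu> a) = \<pi> a \<and>
      compose (topspace (OMap G a)) h' (\<pi> a) = \<mu> a" if a: "a \<in> Ob (Gl I)" for a
  proof -
    have "\<pi> a \<in> extensional (topspace (OMap G a))" "\<mu> a \<in> extensional (topspace (OMap G a))"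
      "\<And>x. x \<in> topspace (OMap G a) \<Longrightarrow> \<pi> a x \<in> topspace L"
      "\<And>x. x \<in> topspace (OMap G a) \<Longrightarrow> \<mu> a x \<in> topspace M"
      using L[OF a] M[OF a] by (auto simp: TopCat_def dest: continuous_map_funspace)
    then show ?thesis using hk(2)[OF a]
      by (auto simp: compose_def h'_def k'_def restrict_def fun_eq_iff extensional_def)
  qed
  ultimately show "cone_iso (dual TopCat) (Gl I) G L \<pi> M \<mu>"
    unfolding cone_iso_def cone_mor_def dual_def
    by (intro exI[of _ k'] exI[of _ h']) (auto simp: TopCat_def)
qed

end

theory Submission
  imports Defs
begin

text \<open>All three conditions say that \<open>\<iota>\<close> is a cocone of continuous maps and that \<open>Q\<close> is obtained
  by gluing the spaces \<open>G(i)\<close>: it carries the final topology of the maps \<open>\<iota>\<^sub>i\<close>, is covered by their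
  images, and \<open>\<iota>\<^sub>i x = \<iota>\<^sub>j y\<close> exactly if \<open>(x, i)\<close> and \<open>(y, j)\<close> are related by \<open>glue_rel\<close>.  The
  predicate \<open>glued_from\<close> below expresses the part about \<open>Q\<close>; it allows points of any type, so that
  it applies to \<open>Q\<close>, to a limit of \<open>G\<close> and to the standard representative alike.

  The standard representative is of this kind as soon as \<open>glue_rel\<close> is an equivalence relation.
  Transitivity is where the triple objects enter: \<open>G(j,i,k)\<close> is the pullback of \<open>G(j,i)\<close> and
  \<open>G(j,k)\<close>, so two overlaps at a point of \<open>G(j)\<close> come from a point of \<open>G(j,i,k)\<close>, which by
  \<open>\<tau>\<close> also lies over \<open>G(i,k)\<close>.  Compatible continuous maps descend to any space glued in this
  way (\<open>glued_from_descent\<close>), hence, together with a cocone, such a space is a colimit of topological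
  spaces (\<open>glued_from_imp_is_limit\<close>), and it is isomorphic to the standard representative
  (\<open>top_cone_iso_std_iff_glued_from\<close>).

  Conversely a limit \<open>M\<close> in the dual category is such a space (\<open>is_limit_imp_glued_from\<close>).  It
  is not clear beforehand that the points of the quotient space fit into the universe \<open>'u\<close>, so \<open>M\<close>
  cannot be compared with it by their universal properties.  It is enough, however, to test \<open>M\<close>
  against spaces of two points.  Maps into the indiscrete one show that every family of subsets of the
  \<open>G(i)\<close> that is compatible with \<open>glue_rel\<close> is the family of preimages of a unique subset of \<open>M\<close>;
  maps into the Sierpinski space show that this subset is open if the family consists of open
  sets.  Covering, separation of points and the final topology are three instances of this.

  The conditions on images and injectivity are for maps compatible with \<open>glue_rel\<close> a
  reformulation of the description of their fibres (\<open>eq_iff_glue_rel_iff_images\<close>), and the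
  equations between the \<open>\<iota>\<close> amount to the cocone equations for the generating arrows (\<open>pt_cocone_iff_generators\<close>).\<close>

section \<open>Objects and arrows of the gluing index category\<close>

lemma gl_eqv_class_eq: "(v, w) \<in> gl_eqv I \<Longrightarrow> gl_eqv I `` {v} = gl_eqv I `` {w}"
  by (auto intro: gl_eqv.sym gl_eqv.trans)

lemma ob2_same: "i \<in> I \<Longrightarrow> ob2 I i i = ob1 I i"
  unfolding ob1_def ob2_def by (rule gl_eqv_class_eq[symmetric, OF gl_eqv.one])

lemma gl_arrow_Ob: "gl_arrow I a b \<Longrightarrow> a \<in> Ob (Gl I) \<and> b \<in> Ob (Gl I)"
  by (induction rule: gl_arrow.induct) (auto simp: gl_ob intro: gl_ob, auto simp: Gl_def)

lemma Ob_Gl_cases [consumes 1]: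
  assumes "a \<in> Ob (Gl I)"
  obtains i where "i \<in> I" "a = ob1 I i"
  | i j where "i \<in> I" "j \<in> I" "a = ob2 I i j"
  | i j k where "i \<in> I" "j \<in> I" "k \<in> I" "a = ob3 I i j k"
proof -
  have "a \<in> gl_words I // gl_eqv I" using assms by (simp add: Gl_def)
  then obtain w where w: "w \<in> gl_words I" and a: "a = gl_eqv I `` {w}" by (rule quotientE)
  show thesis
  proof (cases w)
    case (W1 i)
    then show thesis using w a by (intro that(1)[of i]) (simp_all add: gl_words_def ob1_def)
  next
    case (W2 i j)
    then show thesis using w a by (intro that(2)[of i j]) (simp_all add: gl_words_def ob2_def)
  next
    case (W3 i j k)
    then show thesis using w a by (intro that(3)[of i j k]) (simp_all add: gl_words_def ob3_def)
  qed
qed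

lemma gl_arrow_snd: "i \<in> I \<Longrightarrow> j \<in> I \<Longrightarrow> gl_arrow I (ob1 I j) (ob2 I i j)"
  by (rule gl_arrow.comp[OF gl_arrow.eta1 gl_arrow.tau2])

lemma gl_arrow_eta3:
  "i \<in> I \<Longrightarrow> j \<in> I \<Longrightarrow> k \<in> I \<Longrightarrow> gl_arrow I (ob1 I i) (ob3 I i j k)"
  by (rule gl_arrow.comp[OF gl_arrow.eta1[of i I j] gl_arrow.eta2]) auto

lemma ob_first_in: "a \<in> Ob (Gl I) \<Longrightarrow> ob_first a \<in> I"
  by (erule Ob_Gl_cases) (auto simp: ob_first_simps)

text \<open>Every object receives an arrow from a single index, so a cocone is determined by its
  components at the \<open>[i]\<close>.\<close>

lemma gl_arrow_from_first: "a \<in> Ob (Gl I) \<Longrightarrow> gl_arrow I (ob1 I (ob_first a)) a"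
  by (erule Ob_Gl_cases)
    (auto simp: ob_first_simps gl_arrow.eta1 gl_arrow_eta3 intro!: gl_arrow.ide,
      auto simp: Gl_def dest: gl_ob)

section \<open>Two-point test spaces\<close>

text \<open>The indiscrete space on \<open>{p, q}\<close>, or, if \<open>s\<close> holds, the Sierpinski space with open point \<open>p\<close>.
  For \<open>p \<noteq> q\<close>, maps into the former are subsets of the source, maps into the latter open subsets.\<close>

definition two_point :: "'u \<Rightarrow> 'u \<Rightarrow> bool \<Rightarrow> 'u topology" where
  "two_point p q s = topology (\<lambda>U. U = {} \<or> U = {p, q} \<or> s \<and> U = {p})"

lemma openin_two_point: "openin (two_point p q s) U \<longleftrightarrow> U = {} \<or> U = {p, q} \<or> s \<and> U = {p}"
proof -
  have "istopology (\<lambda>U. U = {} \<or> U = {p, q} \<or> s \<and> U = {p})"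
    unfolding istopology_def
  proof (intro conjI allI impI)
    fix K assume "\<forall>U\<in>K. U = {} \<or> U = {p, q} \<or> s \<and> U = {p}"
    then show "\<Union>K = {} \<or> \<Union>K = {p, q} \<or> s \<and> \<Union>K = {p}"
      by (cases "{p, q} \<in> K"; cases "{p} \<in> K") auto
  qed auto
  then show ?thesis by (simp add: two_point_def topology_inverse')
qed

lemma topspace_two_point: "topspace (two_point p q s) = {p, q}"
proof (rule equalityI)
  show "topspace (two_point p q s) \<subseteq> {p, q}"
    using openin_topspace[of "two_point p q s"] unfolding openin_two_point by auto
  show "{p, q} \<subseteq> topspace (two_point p q s)"
    by (rule openin_subset) (simp add: openin_two_point)
qed

lemma continuous_map_two_point:
  assumes "p \<noteq> q" and "\<And>x. x \<in> topspace X \<Longrightarrow> f x = (if x \<in> A then p else q)"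
  shows "continuous_map X (two_point p q s) f \<longleftrightarrow> (s \<longrightarrow> openin X (topspace X \<inter> A))"
proof -
  have A: "{x \<in> topspace X. f x \<in> {p}} = topspace X \<inter> A"
    using \<open>p \<noteq> q\<close> by (auto simp: assms(2) split: if_splits)
  have full: "{x \<in> topspace X. f x \<in> {p, q}} = topspace X"
    using assms(2) by auto
  have "(\<forall>U. openin (two_point p q s) U \<longrightarrow> openin X {x \<in> topspace X. f x \<in> U}) \<longleftrightarrow>
      (s \<longrightarrow> openin X (topspace X \<inter> A))"
    (is "?l \<longleftrightarrow> ?r")
  proof
    assume ?l
    then have "s \<longrightarrow> openin X {x \<in> topspace X. f x \<in> {p}}" unfolding openin_two_point by blast
    then show ?r unfolding A .
  next
    assume r: ?r
    show ?l
    proof (intro allI impI)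
      fix U assume "openin (two_point p q s) U"
      then consider "U = {}" | "U = {p, q}" | "s" "U = {p}" unfolding openin_two_point by blast
      then show "openin X {x \<in> topspace X. f x \<in> U}"
      proof cases
        case 1
        then show ?thesis by simp
      next
        case 2
        show ?thesis unfolding 2 full by (rule openin_topspace)
      next
        case 3
        show ?thesis unfolding 3(2) A using r 3(1) by blast
      qed
    qed
  qed
  moreover have "f \<in> topspace X \<rightarrow> topspace (two_point p q s)"
    using assms(2) by (simp add: topspace_two_point)
  ultimately show ?thesis by (simp add: continuous_map_def)
qed

section \<open>Points of gluing data\<close>

locale gluing_data =
  fixes I :: "'i set" and G :: "('i, 'u) top_ftor"
  assumes gluing: "gluing_data_functor (dual TopCat) I G"
begin

abbreviation pts :: "'i gl_obj \<Rightarrow> 'u set" where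
  "pts a \<equiv> topspace (OMap G a)"

lemma functor_G: "is_functor (Gl I) (dual TopCat) G"
  using gluing by (simp add: gluing_data_functor_def)

lemma garr_continuous: "gl_arrow I a b \<Longrightarrow> continuous_map (OMap G b) (OMap G a) (garr G a b)"
  using functor_G gl_arrow_Ob[of I a b] unfolding is_functor_def
  by (fastforce simp: Gl_def dual_def TopCat_def)

lemma garr_in: "gl_arrow I a b \<Longrightarrow> x \<in> pts b \<Longrightarrow> garr G a b x \<in> pts a"
  using garr_continuous[of a b] by (auto dest: continuous_map_funspace)

lemma garr_ide: "a \<in> Ob (Gl I) \<Longrightarrow> x \<in> pts a \<Longrightarrow> garr G a a x = x"
  using functor_G unfolding is_functor_def by (simp add: Gl_def dual_def TopCat_def)

lemma garr_comp:
  assumes ab: "gl_arrow I a b" and bc: "gl_arrow I b c" and x: "x \<in> pts c"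
  shows "garr G a b (garr G b c x) = garr G a c x"
proof -
  have "garr G a c = compose (pts c) (garr G a b) (garr G b c)"
    using functor_G gl_arrow_Ob[OF ab] gl_arrow_Ob[OF bc] ab bc unfolding is_functor_def
    by (auto simp: Gl_def dual_def TopCat_def)
  then show ?thesis using x by (simp add: compose_def)
qed

text \<open>A map from a one-point space is a point, so the universal property of the pullback, tested on
  such a space, produces the point of \<open>G(i,j,k)\<close> over two matching points.\<close>

lemma pullback_point:
  assumes ijk: "i \<in> I" "j \<in> I" "k \<in> I"
    and u: "u \<in> pts (ob2 I i j)" and v: "v \<in> pts (ob2 I i k)"
    and eq: "garr G (ob1 I i) (ob2 I i j) u = garr G (ob1 I i) (ob2 I i k) v"
  obtains w where "w \<in> pts (ob3 I i j k)"
    "garr G (ob2 I i j) (ob3 I i j k) w = u" "garr G (ob2 I i k) (ob3 I i j k) w = v"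
proof -
  define p :: 'u where "p = undefined"
  define s where "s = (\<lambda>x\<in>{p}. u)"
  define t where "t = (\<lambda>x\<in>{p}. v)"
  have "is_pushout (dual TopCat) (OMap G (ob1 I i)) (OMap G (ob2 I i j)) (OMap G (ob2 I i k))
          (garr G (ob1 I i) (ob2 I i j)) (garr G (ob1 I i) (ob2 I i k))
          (OMap G (ob3 I i j k))
          (garr G (ob2 I i j) (ob3 I i j k)) (garr G (ob2 I i k) (ob3 I i j k))"
    using gluing ijk by (simp add: gluing_data_functor_def)
  moreover have "discrete_topology {p} \<in> Ob (dual TopCat)" by (simp add: dual_def TopCat_def)
  moreover have "s \<in> Hom (dual TopCat) (OMap G (ob2 I i j)) (discrete_topology {p})"
    "t \<in> Hom (dual TopCat) (OMap G (ob2 I i k)) (discrete_topology {p})"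
    using u v by (auto simp: dual_def TopCat_def s_def t_def)
  moreover have "Cmp (dual TopCat) (OMap G (ob1 I i)) (OMap G (ob2 I i j)) (discrete_topology {p})
      s (garr G (ob1 I i) (ob2 I i j)) =
    Cmp (dual TopCat) (OMap G (ob1 I i)) (OMap G (ob2 I i k)) (discrete_topology {p})
      t (garr G (ob1 I i) (ob2 I i k))"
    using eq by (auto simp: dual_def TopCat_def s_def t_def compose_def)
  ultimately obtain m where
    "m \<in> Hom (dual TopCat) (OMap G (ob3 I i j k)) (discrete_topology {p})"
    "Cmp (dual TopCat) (OMap G (ob2 I i j)) (OMap G (ob3 I i j k)) (discrete_topology {p})
       m (garr G (ob2 I i j) (ob3 I i j k)) = s"
    "Cmp (dual TopCat) (OMap G (ob2 I i k)) (OMap G (ob3 I i j k)) (discrete_topology {p})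
       m (garr G (ob2 I i k) (ob3 I i j k)) = t"
    unfolding is_pushout_def by blast
  then have m: "m p \<in> pts (ob3 I i j k)"
    "compose {p} (garr G (ob2 I i j) (ob3 I i j k)) m = s"
    "compose {p} (garr G (ob2 I i k) (ob3 I i j k)) m = t"
    by (auto simp: dual_def TopCat_def)
  show thesis
    using that[OF m(1)] fun_cong[OF m(2), of p] fun_cong[OF m(3), of p]
    by (simp add: compose_def s_def t_def)
qed

section \<open>The gluing relation is an equivalence\<close>

text \<open>With the composite arrow \<open>[j] \<rightarrow> [j,i] \<rightarrow> [i,j]\<close> the relation becomes symmetric in form:
  it relates the two projections of a point of \<open>G(i,j)\<close>.\<close>

lemma glue_relE:
  assumes "((x, i), (y, j)) \<in> glue_rel I G"
  obtains u where "i \<in> I" "j \<in> I" "u \<in> pts (ob2 I i j)"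
    "x = garr G (ob1 I i) (ob2 I i j) u"
    "y = garr G (ob1 I j) (ob2 I i j) u"
  using assms that by (auto simp: glue_rel_def garr_comp gl_arrow.eta1 gl_arrow.tau2)

lemma glue_relI:
  assumes "i \<in> I" "j \<in> I" "u \<in> pts (ob2 I i j)"
  shows "((garr G (ob1 I i) (ob2 I i j) u, i), (garr G (ob1 I j) (ob2 I i j) u, j)) \<in> glue_rel I G"
proof -
  have "garr G (ob1 I j) (ob2 I i j) u = garr G (ob1 I j) (ob2 I j i) (garr G (ob2 I j i) (ob2 I i j) u)"
    using assms by (simp add: garr_comp gl_arrow.eta1 gl_arrow.tau2)
  then show ?thesis using assms unfolding glue_rel_def by blast
qed

lemma glue_rel_in:
  assumes "((x, i), (y, j)) \<in> glue_rel I G"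
  shows "i \<in> I" "j \<in> I" "x \<in> pts (ob1 I i)" "y \<in> pts (ob1 I j)"
  using assms by (auto elim!: glue_relE intro: garr_in gl_arrow.eta1 gl_arrow_snd)

lemma glue_rel_refl:
  assumes "i \<in> I" "x \<in> pts (ob1 I i)"
  shows "((x, i), (x, i)) \<in> glue_rel I G"
  using glue_relI[of i i x] assms by (simp add: ob2_same garr_ide gl_ob)

text \<open>Both arrows \<open>[i] \<rightarrow> [i,i]\<close> are the same arrow, hence the two projections of a point of
  \<open>G(i,i)\<close> agree.  This makes the maps into a glued space injective.\<close>

lemma glue_rel_same_index:
  assumes "((x, i), (y, i)) \<in> glue_rel I G"
  shows "x = y"
  using assms by (auto elim!: glue_relE)

lemma glue_rel_sym:
  assumes "((x, i), (y, j)) \<in> glue_rel I G"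
  shows "((y, j), (x, i)) \<in> glue_rel I G"
  using assms
proof (rule glue_relE)
  fix u
  assume u: "i \<in> I" "j \<in> I" "u \<in> pts (ob2 I i j)"
    "x = garr G (ob1 I i) (ob2 I i j) u" "y = garr G (ob1 I j) (ob2 I i j) u"
  have "garr G (ob2 I j i) (ob2 I i j) u \<in> pts (ob2 I j i)"
    using u by (simp add: garr_in gl_arrow.tau2)
  from glue_relI[OF u(2,1) this] show ?thesis
    using u by (simp add: garr_comp gl_arrow.eta1 gl_arrow.tau2 gl_arrow_snd)
qed

text \<open>The points of \<open>G(j,i)\<close> and \<open>G(j,k)\<close> that witness the two premises have the same image \<open>y\<close>
  in \<open>G(j)\<close>, so they come from a point of \<open>G(j,i,k)\<close>.  Since \<open>[i,k] \<rightarrow> [i,j,k] \<rightarrow> [j,i,k]\<close> is an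
  arrow, this point has an image in \<open>G(i,k)\<close>, whose projections are \<open>x\<close> and \<open>z\<close> because parallel
  arrows are equal.\<close>

lemma glue_rel_trans:
  assumes xy: "((x, i), (y, j)) \<in> glue_rel I G" and yz: "((y, j), (z, k)) \<in> glue_rel I G"
  shows "((x, i), (z, k)) \<in> glue_rel I G"
proof -
  obtain u where u: "i \<in> I" "j \<in> I" "u \<in> pts (ob2 I j i)"
    "y = garr G (ob1 I j) (ob2 I j i) u" "x = garr G (ob1 I i) (ob2 I j i) u"
    using glue_rel_sym[OF xy] by (rule glue_relE)
  obtain v where v: "k \<in> I" "v \<in> pts (ob2 I j k)"
    "y = garr G (ob1 I j) (ob2 I j k) v" "z = garr G (ob1 I k) (ob2 I j k) v"
    using yz by (rule glue_relE)
  obtain w where w: "w \<in> pts (ob3 I j i k)"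
    "garr G (ob2 I j i) (ob3 I j i k) w = u" "garr G (ob2 I j k) (ob3 I j i k) w = v"
    using pullback_point[OF u(2,1) v(1) u(3) v(2)] u(4) v(3) by metis
  have e: "gl_arrow I (ob2 I j i) (ob3 I j i k)" "gl_arrow I (ob2 I j k) (ob3 I j i k)"
    "gl_arrow I (ob2 I i k) (ob3 I i j k)" "gl_arrow I (ob3 I i j k) (ob3 I j i k)"
    using u v by (auto intro: gl_arrow.eta2 gl_arrow.tau3)
  then have ik: "gl_arrow I (ob2 I i k) (ob3 I j i k)" by (blast intro: gl_arrow.comp)
  define t where "t = garr G (ob2 I i k) (ob3 I j i k) w"
  have "t \<in> pts (ob2 I i k)" using garr_in[OF ik w(1)] by (simp add: t_def)
  from glue_relI[OF u(1) v(1) this] show ?thesis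
    using u v w e ik by (auto simp: t_def garr_comp gl_arrow.eta1 gl_arrow_snd)
qed

lemma equiv_glue_rel: "equiv (glue_sum I G) (glue_rel I G)"
proof (rule equivI)
  show "glue_rel I G \<subseteq> glue_sum I G \<times> glue_sum I G"
    using glue_rel_in by (auto simp: glue_sum_def)
  show "refl_on (glue_sum I G) (glue_rel I G)"
    by (auto simp: refl_on_def glue_sum_def glue_rel_refl)
  show "sym (glue_rel I G)" by (auto simp: sym_def glue_rel_sym)
  show "trans (glue_rel I G)" unfolding trans_def by (auto intro: glue_rel_trans)
qed

section \<open>Glued spaces\<close>

text \<open>The type of points of \<open>Q\<close> is left free, since the standard representative lives in another
  type than the spaces of \<open>G\<close>.\<close>

definition glued_from :: "'a topology \<Rightarrow> ('i \<Rightarrow> 'u \<Rightarrow> 'a) \<Rightarrow> bool" where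
  "glued_from Q f \<longleftrightarrow>
     Q = final_topology (topspace Q) I (\<lambda>i. OMap G (ob1 I i)) f \<and>
     topspace Q = (\<Union>i\<in>I. f i ` pts (ob1 I i)) \<and>
     (\<forall>i\<in>I. \<forall>j\<in>I. \<forall>x\<in>pts (ob1 I i). \<forall>y\<in>pts (ob1 I j).
        f i x = f j y \<longleftrightarrow> ((x, i), (y, j)) \<in> glue_rel I G)"

lemma glued_from_openin:
  assumes "glued_from Q f"
  shows "openin Q U \<longleftrightarrow> U \<subseteq> topspace Q \<and>
    (\<forall>i\<in>I. openin (OMap G (ob1 I i)) {x \<in> pts (ob1 I i). f i x \<in> U})"
  using assms openin_final_topology[of "topspace Q" I "\<lambda>i. OMap G (ob1 I i)" f U]
  unfolding glued_from_def by argo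

lemma glued_from_in: "glued_from Q f \<Longrightarrow> i \<in> I \<Longrightarrow> x \<in> pts (ob1 I i) \<Longrightarrow> f i x \<in> topspace Q"
  unfolding glued_from_def by blast

lemma glued_from_eq_iff:
  "glued_from Q f \<Longrightarrow> i \<in> I \<Longrightarrow> j \<in> I \<Longrightarrow> x \<in> pts (ob1 I i) \<Longrightarrow> y \<in> pts (ob1 I j) \<Longrightarrow>
    f i x = f j y \<longleftrightarrow> ((x, i), (y, j)) \<in> glue_rel I G"
  unfolding glued_from_def by blast

lemma glued_from_cover:
  assumes "glued_from Q f" "q \<in> topspace Q"
  obtains i x where "i \<in> I" "x \<in> pts (ob1 I i)" "q = f i x"
  using assms unfolding glued_from_def by blast

text \<open>The universal property of the quotient: the fibres of \<open>f\<close> are the classes of \<open>glue_rel\<close>, so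
  \<open>h\<close> is well defined, and the final topology makes it continuous.\<close>

lemma glued_from_descent:
  assumes Q: "glued_from Q f"
    and cont: "\<And>i. i \<in> I \<Longrightarrow> continuous_map (OMap G (ob1 I i)) L (g i)"
    and compat: "\<And>i j x y. ((x, i), (y, j)) \<in> glue_rel I G \<Longrightarrow> g i x = g j y"
  obtains h where "continuous_map Q L h"
    "\<And>i x. i \<in> I \<Longrightarrow> x \<in> pts (ob1 I i) \<Longrightarrow> h (f i x) = g i x"
proof -
  have "\<exists>z. \<forall>i\<in>I. \<forall>x\<in>pts (ob1 I i). f i x = q \<longrightarrow> z = g i x" for q
  proof (cases "q \<in> topspace Q")
    case True
    then obtain i x where "i \<in> I" "x \<in> pts (ob1 I i)" "q = f i x"
      using Q by (blast elim: glued_from_cover)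
    then have "\<forall>j\<in>I. \<forall>y\<in>pts (ob1 I j). f j y = q \<longrightarrow> g i x = g j y"
      using compat glued_from_eq_iff[OF Q] by metis
    then show ?thesis by blast
  next
    case False
    then show ?thesis using glued_from_in[OF Q] by blast
  qed
  then obtain h where h: "\<And>q i x. i \<in> I \<Longrightarrow> x \<in> pts (ob1 I i) \<Longrightarrow> f i x = q \<Longrightarrow> h q = g i x"
    by metis
  have hf: "h (f i x) = g i x" if "i \<in> I" "x \<in> pts (ob1 I i)" for i x
    using h[OF that HOL.refl] .
  have "continuous_map Q L h"
    unfolding continuous_map_def
  proof (intro conjI allI impI Pi_I)
    fix q assume "q \<in> topspace Q"
    then obtain i x where "i \<in> I" "x \<in> pts (ob1 I i)" "q = f i x"
      using Q by (blast elim: glued_from_cover)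
    then show "h q \<in> topspace L"
      using hf cont[of i] by (auto dest: continuous_map_funspace)
  next
    fix U assume U: "openin L U"
    have "openin (OMap G (ob1 I i)) {x \<in> pts (ob1 I i). f i x \<in> {q \<in> topspace Q. h q \<in> U}}"
      if i: "i \<in> I" for i
    proof -
      have "{x \<in> pts (ob1 I i). f i x \<in> {q \<in> topspace Q. h q \<in> U}} = {x \<in> pts (ob1 I i). g i x \<in> U}"
        using hf[OF i] glued_from_in[OF Q i] by auto
      then show ?thesis using openin_continuous_map_preimage[OF cont[OF i] U] by simp
    qed
    then show "openin Q {q \<in> topspace Q. h q \<in> U}"
      unfolding glued_from_openin[OF Q] by blast
  qed
  then show thesis using hf that by blast
qed

lemma glued_from_continuous:
  assumes "glued_from Q f" "i \<in> I"
  shows "continuous_map (OMap G (ob1 I i)) Q (f i)"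
  unfolding continuous_map_def
  using assms glued_from_in[OF assms] glued_from_openin[OF assms(1)] by blast

lemma glued_from_homeomorphic_maps:
  assumes M: "glued_from M f" and hk: "homeomorphic_maps M L h k"
    and hf: "\<And>i x. i \<in> I \<Longrightarrow> x \<in> pts (ob1 I i) \<Longrightarrow> h (f i x) = g i x"
  shows "glued_from L g"
proof -
  have cont: "continuous_map M L h" "continuous_map L M k"
    and inv: "\<And>x. x \<in> topspace M \<Longrightarrow> k (h x) = x" "\<And>y. y \<in> topspace L \<Longrightarrow> h (k y) = y"
    using hk by (auto simp: homeomorphic_maps_def)
  have mem: "\<And>x. x \<in> topspace M \<Longrightarrow> h x \<in> topspace L" "\<And>y. y \<in> topspace L \<Longrightarrow> k y \<in> topspace M"
    using cont by (auto dest: continuous_map_funspace)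
  have pre: "{x \<in> pts (ob1 I i). g i x \<in> U} = {x \<in> pts (ob1 I i). f i x \<in> {q \<in> topspace M. h q \<in> U}}"
    if "i \<in> I" for i U
    using hf[OF that] glued_from_in[OF M that] by auto
  have "openin L U \<longleftrightarrow> U \<subseteq> topspace L \<and>
      (\<forall>i\<in>I. openin (OMap G (ob1 I i)) {x \<in> pts (ob1 I i). g i x \<in> U})" for U
  proof
    assume U: "openin L U"
    have "openin M {q \<in> topspace M. h q \<in> U}"
      by (rule openin_continuous_map_preimage[OF cont(1) U])
    then have "\<forall>i\<in>I. openin (OMap G (ob1 I i)) {x \<in> pts (ob1 I i). g i x \<in> U}"
      unfolding glued_from_openin[OF M] by (simp add: pre)
    then show "U \<subseteq> topspace L \<and>
        (\<forall>i\<in>I. openin (OMap G (ob1 I i)) {x \<in> pts (ob1 I i). g i x \<in> U})"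
      using openin_subset[OF U] by blast
  next
    assume U: "U \<subseteq> topspace L \<and>
        (\<forall>i\<in>I. openin (OMap G (ob1 I i)) {x \<in> pts (ob1 I i). g i x \<in> U})"
    have "openin (OMap G (ob1 I i)) {x \<in> pts (ob1 I i). f i x \<in> {q \<in> topspace M. h q \<in> U}}"
      if i: "i \<in> I" for i
      using U i unfolding pre[OF i, symmetric] by blast
    then have "openin M {q \<in> topspace M. h q \<in> U}"
      unfolding glued_from_openin[OF M] by blast
    from openin_continuous_map_preimage[OF cont(2) this]
    have "openin L {y \<in> topspace L. k y \<in> {q \<in> topspace M. h q \<in> U}}" .
    moreover have "{y \<in> topspace L. k y \<in> {q \<in> topspace M. h q \<in> U}} = U"
      using U mem inv by auto
    ultimately show "openin L U" by simp
  qed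
  then have "L = final_topology (topspace L) I (\<lambda>i. OMap G (ob1 I i)) g"
    by (simp add: topology_eq openin_final_topology)
  moreover have "topspace L = (\<Union>i\<in>I. g i ` pts (ob1 I i))"
  proof (intro equalityI subsetI)
    fix y assume y: "y \<in> topspace L"
    obtain i x where "i \<in> I" "x \<in> pts (ob1 I i)" "k y = f i x"
      using M mem(2)[OF y] by (rule glued_from_cover)
    then have "i \<in> I" "x \<in> pts (ob1 I i)" "y = g i x" using hf inv(2)[OF y] by auto
    then show "y \<in> (\<Union>i\<in>I. g i ` pts (ob1 I i))" by blast
  next
    fix y assume "y \<in> (\<Union>i\<in>I. g i ` pts (ob1 I i))"
    then show "y \<in> topspace L" using hf mem(1) glued_from_in[OF M] by force
  qed
  moreover have "g i x = g j y \<longleftrightarrow> ((x, i), (y, j)) \<in> glue_rel I G"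
    if "i \<in> I" "j \<in> I" "x \<in> pts (ob1 I i)" "y \<in> pts (ob1 I j)" for i j x y
    using that hf inv(1) glued_from_in[OF M] glued_from_eq_iff[OF M that] by metis
  ultimately show ?thesis unfolding glued_from_def by blast
qed

section \<open>The standard representative as a glued space\<close>

lemma glue_proj_eq_iff:
  assumes "i \<in> I" "j \<in> I" "x \<in> pts (ob1 I i)" "y \<in> pts (ob1 I j)"
  shows "glue_proj I G (x, i) = glue_proj I G (y, j) \<longleftrightarrow> ((x, i), (y, j)) \<in> glue_rel I G"
  unfolding glue_proj_def
  using eq_equiv_class_iff[OF equiv_glue_rel, of "(x, i)" "(y, j)"] assms
  by (simp add: glue_sum_def)

lemma topspace_std_space: "topspace (std_space I G) = glue_sum I G // glue_rel I G"
proof -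
  have "{x \<in> pts (ob1 I i). glue_proj I G (x, i) \<in> glue_sum I G // glue_rel I G} = pts (ob1 I i)"
    if "i \<in> I" for i
    using that by (auto simp: glue_proj_def glue_sum_def intro!: quotientI)
  then have "openin (std_space I G) (glue_sum I G // glue_rel I G)"
    by (simp add: std_space_def openin_final_topology)
  moreover have "topspace (std_space I G) \<subseteq> glue_sum I G // glue_rel I G"
    using openin_topspace[of "std_space I G"]
    unfolding std_space_def openin_final_topology by blast
  ultimately show ?thesis by (simp add: openin_subset subset_antisym)
qed

lemma glued_from_std_space: "glued_from (std_space I G) (\<lambda>i x. glue_proj I G (x, i))"
  unfolding glued_from_def
proof (intro conjI ballI)
  show "std_space I G = final_topology (topspace (std_space I G)) I (\<lambda>i. OMap G (ob1 I i))
      (\<lambda>i x. glue_proj I G (x, i))"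
    unfolding topspace_std_space by (simp add: std_space_def)
  show "topspace (std_space I G) = (\<Union>i\<in>I. (\<lambda>x. glue_proj I G (x, i)) ` pts (ob1 I i))"
    unfolding topspace_std_space
    by (auto simp: quotient_def glue_proj_def glue_sum_def)
qed (use glue_proj_eq_iff in blast)

section \<open>Cocones\<close>

text \<open>The cone equations in \<open>dual TopCat\<close>, read pointwise.  Continuity and extensionality are left
  out, so that the maps may take values in any type, for instance in truth values when subsets are
  glued.\<close>

definition pt_cocone :: "('i gl_obj \<Rightarrow> 'u \<Rightarrow> 'a) \<Rightarrow> bool" where
  "pt_cocone \<mu> \<longleftrightarrow> (\<forall>a b. gl_arrow I a b \<longrightarrow> (\<forall>x\<in>pts b. \<mu> b x = \<mu> a (garr G a b x)))"

lemma pt_coconeD: "pt_cocone \<mu> \<Longrightarrow> gl_arrow I a b \<Longrightarrow> x \<in> pts b \<Longrightarrow> \<mu> a (garr G a b x) = \<mu> b x"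
  unfolding pt_cocone_def by simp

lemma pt_cocone_first:
  "pt_cocone \<mu> \<Longrightarrow> a \<in> Ob (Gl I) \<Longrightarrow> x \<in> pts a \<Longrightarrow>
    \<mu> (ob1 I (ob_first a)) (garr G (ob1 I (ob_first a)) a x) = \<mu> a x"
  by (simp add: pt_coconeD gl_arrow_from_first)

lemma cone_over_iff_pt_cocone:
  assumes "\<forall>a\<in>Ob (Gl I). \<mu> a \<in> Hom TopCat (OMap G a) L"
  shows "cone_over (dual TopCat) (Gl I) G L \<mu> \<longleftrightarrow> pt_cocone \<mu>"
proof -
  have "compose (pts b) (\<mu> a) (garr G a b) = \<mu> b \<longleftrightarrow> (\<forall>x\<in>pts b. \<mu> b x = \<mu> a (garr G a b x))"
    if "gl_arrow I a b" for a b
  proof -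
    have "\<mu> b \<in> extensional (pts b)" using assms gl_arrow_Ob[OF that] by (auto simp: TopCat_def)
    then show ?thesis by (auto simp: compose_def restrict_def fun_eq_iff extensional_def)
  qed
  moreover have "cone_over (dual TopCat) (Gl I) G L \<mu> \<longleftrightarrow>
      (\<forall>a\<in>Ob (Gl I). \<forall>b\<in>Ob (Gl I). gl_arrow I a b \<longrightarrow>
        compose (pts b) (\<mu> a) (garr G a b) = \<mu> b)"
    using assms by (simp add: cone_over_def dual_def TopCat_def) (simp add: Gl_def)
  ultimately show ?thesis
    using gl_arrow_Ob unfolding pt_cocone_def by blast
qed

lemma pt_cocone_glue_rel:
  assumes "pt_cocone \<mu>" "((x, i), (y, j)) \<in> glue_rel I G"
  shows "\<mu> (ob1 I i) x = \<mu> (ob1 I j) y"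
  using assms(2)
  by (rule glue_relE) (use assms(1) in \<open>auto simp: pt_coconeD gl_arrow.eta1 gl_arrow_snd\<close>)

text \<open>A compatible family on the \<open>G(i)\<close> extends to all objects along the arrows from their first
  letter.  For a generating arrow \<open>a \<rightarrow> b\<close> that keeps the first letter the cocone equation is
  functoriality.  The arrows \<open>\<tau>\<close> exchange the first two letters \<open>i, j\<close>; on the image in
  \<open>G(i,j)\<close> of the given point, the equation is compatibility with \<open>glue_rel\<close>.\<close>

lemma pt_cocone_of_compatible:
  assumes compat: "\<And>i j x y. ((x, i), (y, j)) \<in> glue_rel I G \<Longrightarrow> f i x = f j y"
  shows "pt_cocone (\<lambda>a x. f (ob_first a) (garr G (ob1 I (ob_first a)) a x))"
proof -
  have swap: "f i (garr G (ob1 I i) (ob2 I i j) u) = f j (garr G (ob1 I j) (ob2 I i j) u)"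
    if "i \<in> I" "j \<in> I" "u \<in> pts (ob2 I i j)" for i j u
    using that by (intro compat glue_relI)
  have "\<forall>x\<in>pts b. f (ob_first b) (garr G (ob1 I (ob_first b)) b x) =
      f (ob_first a) (garr G (ob1 I (ob_first a)) b x)" if "gl_arrow I a b" for a b
    using that
  proof (induction rule: gl_arrow.induct)
    case (tau2 i j)
    then show ?case using swap[OF tau2] by (simp add: ob_first_simps)
  next
    case (tau3 i j k)
    show ?case
    proof
      fix x assume x: "x \<in> pts (ob3 I i j k)"
      have e: "gl_arrow I (ob2 I i j) (ob3 I i j k)" using tau3 by (simp add: gl_arrow.eta2)
      show "f (ob_first (ob3 I i j k)) (garr G (ob1 I (ob_first (ob3 I i j k))) (ob3 I i j k) x) =
        f (ob_first (ob3 I j i k)) (garr G (ob1 I (ob_first (ob3 I j i k))) (ob3 I i j k) x)"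
        using swap[OF tau3(1,2) garr_in[OF e x]] tau3 x e
        by (simp add: ob_first_simps garr_comp gl_arrow.eta1 gl_arrow_snd)
    qed
  next
    case (comp a b c)
    show ?case
    proof
      fix x assume x: "x \<in> pts c"
      have F: "gl_arrow I (ob1 I (ob_first a)) b" "gl_arrow I (ob1 I (ob_first b)) b"
        using comp.hyps gl_arrow_Ob gl_arrow_from_first by (blast intro: gl_arrow.comp)+
      show "f (ob_first c) (garr G (ob1 I (ob_first c)) c x) =
          f (ob_first a) (garr G (ob1 I (ob_first a)) c x)"
        using comp.IH garr_in[OF comp.hyps(2) x] x F comp.hyps
        by (metis garr_comp)
    qed
  qed (auto simp: ob_first_simps)
  then show ?thesis
    unfolding pt_cocone_def
    using gl_arrow_Ob gl_arrow_from_first garr_comp by metis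
qed

section \<open>Limits in the dual category are glued spaces\<close>

lemma is_limit_descent:
  assumes lim: "is_limit (dual TopCat) (Gl I) G M \<mu>"
    and \<nu>: "\<forall>a\<in>Ob (Gl I). \<nu> a \<in> Hom TopCat (OMap G a) L" "pt_cocone \<nu>"
  shows "\<exists>!h. h \<in> Hom TopCat M L \<and> (\<forall>a\<in>Ob (Gl I). compose (pts a) h (\<mu> a) = \<nu> a)"
proof -
  have "cone_over (dual TopCat) (Gl I) G L \<nu>" using \<nu> by (simp add: cone_over_iff_pt_cocone)
  then have "\<exists>!h. cone_mor (dual TopCat) (Gl I) G L \<nu> M \<mu> h"
    using lim by (simp add: is_limit_def)
  then show ?thesis by (simp add: cone_mor_def dual_def TopCat_def)
qed

lemma is_limit_Hom:
  assumes "is_limit (dual TopCat) (Gl I) G M \<mu>"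
  shows "\<forall>a\<in>Ob (Gl I). \<mu> a \<in> Hom TopCat (OMap G a) M" "pt_cocone \<mu>"
proof -
  have c: "cone_over (dual TopCat) (Gl I) G M \<mu>" using assms by (simp add: is_limit_def)
  then show H: "\<forall>a\<in>Ob (Gl I). \<mu> a \<in> Hom TopCat (OMap G a) M"
    by (simp add: cone_over_def dual_def)
  show "pt_cocone \<mu>" using c cone_over_iff_pt_cocone[OF H] by simp
qed

text \<open>A compatible family \<open>A\<close> of subsets of the \<open>G(i)\<close> is the same as a cocone of maps into a
  two-point space, and a subset \<open>B\<close> of \<open>M\<close> is the same as a map from \<open>M\<close> into it.  The universal
  property of \<open>M\<close> therefore yields exactly one \<open>B\<close> with preimages \<open>A\<close>.  The parameter \<open>s\<close> selects
  the Sierpinski space, for which both \<open>A\<close> and \<open>B\<close> consist of open sets.\<close>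

lemma is_limit_subset:
  fixes p q :: 'u
  assumes lim: "is_limit (dual TopCat) (Gl I) G M \<mu>" and pq: "p \<noteq> q"
    and compat: "\<And>i j x y. ((x, i), (y, j)) \<in> glue_rel I G \<Longrightarrow> x \<in> A i \<longleftrightarrow> y \<in> A j"
    and opn: "\<And>i. s \<Longrightarrow> i \<in> I \<Longrightarrow> openin (OMap G (ob1 I i)) (pts (ob1 I i) \<inter> A i)"
  shows "\<exists>!B. B \<subseteq> topspace M \<and> (s \<longrightarrow> openin M B) \<and>
    (\<forall>i\<in>I. \<forall>x\<in>pts (ob1 I i). \<mu> (ob1 I i) x \<in> B \<longleftrightarrow> x \<in> A i)"
proof -
  define chi :: "'u topology \<Rightarrow> 'u set \<Rightarrow> 'u \<Rightarrow> 'u"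
    where "chi X B = (\<lambda>x\<in>topspace X. if x \<in> B then p else q)" for X B
  \<comment> \<open>the extension of \<open>A\<close> from the indices to all objects\<close>
  define D where "D a = {x. garr G (ob1 I (ob_first a)) a x \<in> A (ob_first a)}" for a
  have chi_Hom: "chi X B \<in> Hom TopCat X (two_point p q s) \<longleftrightarrow> (s \<longrightarrow> openin X (topspace X \<inter> B))"
    for X B
    using continuous_map_two_point[OF pq, of X "chi X B" B s] by (simp add: chi_def TopCat_def)
  have D1: "x \<in> D (ob1 I i) \<longleftrightarrow> x \<in> A i" if "i \<in> I" "x \<in> pts (ob1 I i)" for i x
    using that by (simp add: D_def ob_first_simps garr_ide gl_ob)
  have D_cocone: "pt_cocone (\<lambda>a x. x \<in> D a)"
    using pt_cocone_of_compatible[of "\<lambda>i x. x \<in> A i"] compat by (simp add: D_def)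
  have "chi (OMap G a) (D a) \<in> Hom TopCat (OMap G a) (two_point p q s)" if a: "a \<in> Ob (Gl I)" for a
  proof -
    let ?b = "ob1 I (ob_first a)"
    have "openin (OMap G a) {x \<in> pts a. garr G ?b a x \<in> pts ?b \<inter> A (ob_first a)}" if s
      using openin_continuous_map_preimage[OF garr_continuous[OF gl_arrow_from_first[OF a]]]
        opn[OF that ob_first_in[OF a]] .
    moreover have "{x \<in> pts a. garr G ?b a x \<in> pts ?b \<inter> A (ob_first a)} = pts a \<inter> D a"
      using garr_in[OF gl_arrow_from_first[OF a]] by (auto simp: D_def)
    ultimately show ?thesis by (simp add: chi_Hom)
  qed
  moreover have "pt_cocone (\<lambda>a. chi (OMap G a) (D a))"
    using D_cocone garr_in unfolding pt_cocone_def by (simp add: chi_def)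
  ultimately have ex1: "\<exists>!h. h \<in> Hom TopCat M (two_point p q s) \<and>
      (\<forall>a\<in>Ob (Gl I). compose (pts a) h (\<mu> a) = chi (OMap G a) (D a))"
    by (intro is_limit_descent[OF lim]) auto
  note \<mu> = is_limit_Hom[OF lim]
  have \<mu>_in: "\<mu> a x \<in> topspace M" if "a \<in> Ob (Gl I)" "x \<in> pts a" for a x
    using \<mu>(1) that by (auto simp: TopCat_def dest: continuous_map_funspace)
  have factor: "(\<forall>a\<in>Ob (Gl I). compose (pts a) (chi M B) (\<mu> a) = chi (OMap G a) (D a)) \<longleftrightarrow>
      (\<forall>i\<in>I. \<forall>x\<in>pts (ob1 I i). \<mu> (ob1 I i) x \<in> B \<longleftrightarrow> x \<in> A i)" for B
  proof -
    have "compose (pts a) (chi M B) (\<mu> a) = chi (OMap G a) (D a) \<longleftrightarrow>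
        (\<forall>x\<in>pts a. \<mu> a x \<in> B \<longleftrightarrow> x \<in> D a)" if "a \<in> Ob (Gl I)" for a
      using \<mu>_in[OF that] pq by (auto simp: compose_def chi_def restrict_def fun_eq_iff)
    moreover have "(\<forall>a\<in>Ob (Gl I). \<forall>x\<in>pts a. \<mu> a x \<in> B \<longleftrightarrow> x \<in> D a) \<longleftrightarrow>
        (\<forall>i\<in>I. \<forall>x\<in>pts (ob1 I i). \<mu> (ob1 I i) x \<in> B \<longleftrightarrow> x \<in> A i)"
    proof
      assume R: "\<forall>i\<in>I. \<forall>x\<in>pts (ob1 I i). \<mu> (ob1 I i) x \<in> B \<longleftrightarrow> x \<in> A i"
      show "\<forall>a\<in>Ob (Gl I). \<forall>x\<in>pts a. \<mu> a x \<in> B \<longleftrightarrow> x \<in> D a"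
      proof (intro ballI)
        fix a x assume a: "a \<in> Ob (Gl I)" and x: "x \<in> pts a"
        have "garr G (ob1 I (ob_first a)) a x \<in> pts (ob1 I (ob_first a))"
          using garr_in[OF gl_arrow_from_first[OF a] x] .
        then show "\<mu> a x \<in> B \<longleftrightarrow> x \<in> D a"
          using R ob_first_in[OF a] pt_cocone_first[OF \<mu>(2) a x]
          unfolding D_def mem_Collect_eq by metis
      qed
    qed (use gl_ob(1) D1 in metis)
    ultimately show ?thesis by simp
  qed
  have chi_surj: "\<exists>B\<subseteq>topspace M. h = chi M B" if "h \<in> Hom TopCat M (two_point p q s)" for h
  proof (intro exI conjI)
    have "h x \<in> {p, q}" if "x \<in> topspace M" for x
      using \<open>h \<in> _\<close> that continuous_map_funspace[of M "two_point p q s" h]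
      by (auto simp: TopCat_def topspace_two_point)
    then show "h = chi M {x \<in> topspace M. h x = p}"
      using \<open>h \<in> _\<close> by (fastforce simp: chi_def TopCat_def extensional_def)
  qed auto
  have chi_inj: "B = C" if "chi M B = chi M C" "B \<subseteq> topspace M" "C \<subseteq> topspace M" for B C
  proof -
    have "x \<in> B \<longleftrightarrow> x \<in> C" if "x \<in> topspace M" for x
      using fun_cong[OF \<open>chi M B = chi M C\<close>, of x] that pq by (auto simp: chi_def split: if_splits)
    then show ?thesis using that by blast
  qed
  have opn_iff: "chi M B \<in> Hom TopCat M (two_point p q s) \<longleftrightarrow> (s \<longrightarrow> openin M B)"
    if "B \<subseteq> topspace M" for B
    using that by (simp add: chi_Hom Int_absorb1)
  obtain h where h: "h \<in> Hom TopCat M (two_point p q s)"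
      "\<forall>a\<in>Ob (Gl I). compose (pts a) h (\<mu> a) = chi (OMap G a) (D a)"
    and unique: "\<And>h'. h' \<in> Hom TopCat M (two_point p q s) \<Longrightarrow>
      \<forall>a\<in>Ob (Gl I). compose (pts a) h' (\<mu> a) = chi (OMap G a) (D a) \<Longrightarrow> h' = h"
    using ex1 by blast
  obtain B where B: "B \<subseteq> topspace M" "h = chi M B" using chi_surj[OF h(1)] by blast
  show ?thesis
  proof (rule ex1I[of _ B])
    show "B \<subseteq> topspace M \<and> (s \<longrightarrow> openin M B) \<and>
        (\<forall>i\<in>I. \<forall>x\<in>pts (ob1 I i). \<mu> (ob1 I i) x \<in> B \<longleftrightarrow> x \<in> A i)"
      using B(1) h[unfolded B(2)] opn_iff[OF B(1)] factor[of B] by blast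
  next
    fix C
    assume C: "C \<subseteq> topspace M \<and> (s \<longrightarrow> openin M C) \<and>
        (\<forall>i\<in>I. \<forall>x\<in>pts (ob1 I i). \<mu> (ob1 I i) x \<in> C \<longleftrightarrow> x \<in> A i)"
    then have "chi M C = chi M B"
      unfolding B(2)[symmetric] using opn_iff[of C] factor[of C] by (intro unique) blast+
    then show "C = B" using chi_inj C B(1) by blast
  qed
qed

text \<open>Three families of subsets are fed to the preceding lemma.  For the family of all points both
  \<open>M\<close> and the union of the images have the right preimages, so they coincide.  For the \<open>glue_rel\<close>
  class of \<open>(x, i)\<close> one obtains a subset of \<open>M\<close> that separates \<open>x\<close> from all unrelated points.  If
  \<open>U\<close> has open preimages, the open set with these preimages must be \<open>U\<close>, since the images
  cover \<open>M\<close>.\<close>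

lemma is_limit_imp_glued_from:
  assumes universe: "\<exists>x y :: 'u. x \<noteq> y" and lim: "is_limit (dual TopCat) (Gl I) G M \<mu>"
  shows "glued_from M (\<lambda>i. \<mu> (ob1 I i))"
proof -
  obtain p q :: 'u where pq: "p \<noteq> q" using universe by blast
  note sub = is_limit_subset[OF lim pq]
  note \<mu> = is_limit_Hom[OF lim]
  have cont: "continuous_map (OMap G (ob1 I i)) M (\<mu> (ob1 I i))" if "i \<in> I" for i
    using \<mu>(1) gl_ob(1)[OF that] by (auto simp: TopCat_def)
  have in_M: "\<mu> (ob1 I i) x \<in> topspace M" if "i \<in> I" "x \<in> pts (ob1 I i)" for i x
    using cont[OF that(1)] that(2) by (auto dest: continuous_map_funspace)
  have cover: "topspace M = (\<Union>i\<in>I. \<mu> (ob1 I i) ` pts (ob1 I i))" (is "_ = ?V")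
  proof -
    have "\<exists>!B. B \<subseteq> topspace M \<and> (False \<longrightarrow> openin M B) \<and>
        (\<forall>i\<in>I. \<forall>x\<in>pts (ob1 I i). \<mu> (ob1 I i) x \<in> B \<longleftrightarrow> x \<in> UNIV)"
      by (rule sub) auto
    then obtain B where unique: "\<And>C. C \<subseteq> topspace M \<and> (False \<longrightarrow> openin M C) \<and>
        (\<forall>i\<in>I. \<forall>x\<in>pts (ob1 I i). \<mu> (ob1 I i) x \<in> C \<longleftrightarrow> x \<in> UNIV) \<Longrightarrow> C = B"
      by (elim ex1E) blast
    have "topspace M = B" by (rule unique) (simp add: in_M)
    moreover have "?V = B" by (rule unique) (use in_M in blast)
    ultimately show ?thesis by simp
  qed
  have sep: "((x, i), (y, j)) \<in> glue_rel I G"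
    if ij: "i \<in> I" "j \<in> I" "x \<in> pts (ob1 I i)" "y \<in> pts (ob1 I j)"
      and eq: "\<mu> (ob1 I i) x = \<mu> (ob1 I j) y" for i j x y
  proof -
    let ?A = "\<lambda>k. {z. ((x, i), (z, k)) \<in> glue_rel I G}"
    have "\<exists>!B. B \<subseteq> topspace M \<and> (False \<longrightarrow> openin M B) \<and>
        (\<forall>k\<in>I. \<forall>z\<in>pts (ob1 I k). \<mu> (ob1 I k) z \<in> B \<longleftrightarrow> z \<in> ?A k)"
      by (rule sub) (auto intro: glue_rel_trans glue_rel_sym)
    then obtain B where B: "\<forall>k\<in>I. \<forall>z\<in>pts (ob1 I k). \<mu> (ob1 I k) z \<in> B \<longleftrightarrow> z \<in> ?A k" by blast
    have "\<mu> (ob1 I i) x \<in> B" using B ij glue_rel_refl by blast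
    then show ?thesis using B ij eq by auto
  qed
  have "openin M U" if U: "U \<subseteq> topspace M"
    "\<forall>i\<in>I. openin (OMap G (ob1 I i)) {x \<in> pts (ob1 I i). \<mu> (ob1 I i) x \<in> U}" for U
  proof -
    let ?A = "\<lambda>i. {x. \<mu> (ob1 I i) x \<in> U}"
    have compat: "x \<in> ?A i \<longleftrightarrow> y \<in> ?A j" if "((x, i), (y, j)) \<in> glue_rel I G" for i j x y
      using pt_cocone_glue_rel[OF \<mu>(2) that] by simp
    have "\<exists>!B. B \<subseteq> topspace M \<and> (True \<longrightarrow> openin M B) \<and>
        (\<forall>i\<in>I. \<forall>x\<in>pts (ob1 I i). \<mu> (ob1 I i) x \<in> B \<longleftrightarrow> x \<in> ?A i)"
      using U(2) by (intro sub compat) (auto simp: Collect_conj_eq)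
    then obtain B where B: "B \<subseteq> topspace M" "openin M B"
        "\<forall>i\<in>I. \<forall>x\<in>pts (ob1 I i). \<mu> (ob1 I i) x \<in> B \<longleftrightarrow> \<mu> (ob1 I i) x \<in> U" by auto
    then have "B = U" using U(1) unfolding cover by blast
    then show ?thesis using B by simp
  qed
  then have "openin M U \<longleftrightarrow> U \<subseteq> topspace M \<and>
      (\<forall>i\<in>I. openin (OMap G (ob1 I i)) {x \<in> pts (ob1 I i). \<mu> (ob1 I i) x \<in> U})" for U
    using openin_continuous_map_preimage[OF cont] openin_subset by blast
  then have "M = final_topology (topspace M) I (\<lambda>i. OMap G (ob1 I i)) (\<lambda>i. \<mu> (ob1 I i))"
    by (simp add: topology_eq openin_final_topology)
  then show ?thesis
    unfolding glued_from_def using cover sep pt_cocone_glue_rel[OF \<mu>(2)] by blast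
qed

section \<open>Glued spaces are limits in the dual category\<close>

text \<open>The mediating map comes from descent, and it is unique because the images cover \<open>Q\<close>.\<close>

lemma glued_from_imp_is_limit:
  assumes Q: "glued_from Q (\<lambda>i. \<iota> (ob1 I i))"
    and family: "\<forall>a\<in>Ob (Gl I). \<iota> a \<in> Hom TopCat (OMap G a) Q" and \<iota>: "pt_cocone \<iota>"
  shows "is_limit (dual TopCat) (Gl I) G Q \<iota>"
  unfolding is_limit_def
proof (intro conjI allI impI)
  show "cone_over (dual TopCat) (Gl I) G Q \<iota>"
    using family \<iota> by (simp add: cone_over_iff_pt_cocone)
  fix L \<pi> assume c: "cone_over (dual TopCat) (Gl I) G L \<pi>"
  then have H: "\<forall>a\<in>Ob (Gl I). \<pi> a \<in> Hom TopCat (OMap G a) L"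
    by (simp add: cone_over_def dual_def)
  then have \<pi>: "pt_cocone \<pi>" using c cone_over_iff_pt_cocone by blast
  \<comment> \<open>a morphism of cones only has to be tested on single indices\<close>
  have mor: "cone_mor (dual TopCat) (Gl I) G L \<pi> Q \<iota> h \<longleftrightarrow>
      h \<in> Hom TopCat Q L \<and> (\<forall>i\<in>I. \<forall>x\<in>pts (ob1 I i). h (\<iota> (ob1 I i) x) = \<pi> (ob1 I i) x)" for h
  proof -
    have "compose (pts a) h (\<iota> a) = \<pi> a \<longleftrightarrow> (\<forall>x\<in>pts a. h (\<iota> a x) = \<pi> a x)"
      if "a \<in> Ob (Gl I)" for a
      using H that by (auto simp: TopCat_def compose_def restrict_def fun_eq_iff extensional_def)
    moreover have "(\<forall>a\<in>Ob (Gl I). \<forall>x\<in>pts a. h (\<iota> a x) = \<pi> a x) \<longleftrightarrow>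
      (\<forall>i\<in>I. \<forall>x\<in>pts (ob1 I i). h (\<iota> (ob1 I i) x) = \<pi> (ob1 I i) x)"
      using pt_cocone_first[OF \<iota>] pt_cocone_first[OF \<pi>] ob_first_in gl_ob(1)
        garr_in[OF gl_arrow_from_first] by metis
    ultimately show ?thesis by (simp add: cone_mor_def dual_def) (simp add: TopCat_def)
  qed
  have "continuous_map (OMap G (ob1 I i)) L (\<pi> (ob1 I i))" if "i \<in> I" for i
    using H gl_ob(1)[OF that] by (auto simp: TopCat_def)
  then obtain h where h: "continuous_map Q L h"
    "\<And>i x. i \<in> I \<Longrightarrow> x \<in> pts (ob1 I i) \<Longrightarrow> h (\<iota> (ob1 I i) x) = \<pi> (ob1 I i) x"
    using glued_from_descent[OF Q, of L "\<lambda>i. \<pi> (ob1 I i)"] pt_cocone_glue_rel[OF \<pi>] by metis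
  show "\<exists>!h. cone_mor (dual TopCat) (Gl I) G L \<pi> Q \<iota> h"
    unfolding mor
  proof (intro ex1I conjI ballI)
    show "restrict h (topspace Q) \<in> Hom TopCat Q L"
      using continuous_map_eq[OF h(1), of "restrict h (topspace Q)"] by (simp add: TopCat_def)
    show "restrict h (topspace Q) (\<iota> (ob1 I i) x) = \<pi> (ob1 I i) x"
      if "i \<in> I" "x \<in> pts (ob1 I i)" for i x
      using that h(2) glued_from_in[OF Q that] by simp
    fix k
    assume k: "k \<in> Hom TopCat Q L \<and>
      (\<forall>i\<in>I. \<forall>x\<in>pts (ob1 I i). k (\<iota> (ob1 I i) x) = \<pi> (ob1 I i) x)"
    show "k = restrict h (topspace Q)"
    proof (rule extensionalityI)
      show "k \<in> extensional (topspace Q)" using k by (simp add: TopCat_def)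
      fix z assume z: "z \<in> topspace Q"
      then obtain i x where "i \<in> I" "x \<in> pts (ob1 I i)" "z = \<iota> (ob1 I i) x"
        using Q by (blast elim: glued_from_cover)
      then show "k z = restrict h (topspace Q) z" using k h(2) z by simp
    qed simp
  qed
qed

lemma glued_up_iff_glued_from:
  assumes universe: "\<exists>x y :: 'u. x \<noteq> y"
    and family: "\<forall>a\<in>Ob (Gl I). \<iota> a \<in> Hom TopCat (OMap G a) Q"
  shows "glued_up (dual TopCat) I G Q \<iota> \<longleftrightarrow> pt_cocone \<iota> \<and> glued_from Q (\<lambda>i. \<iota> (ob1 I i))"
proof
  assume g: "glued_up (dual TopCat) I G Q \<iota>"
  then obtain M \<mu> where lim: "is_limit (dual TopCat) (Gl I) G M \<mu>"
    and iso: "cone_iso (dual TopCat) (Gl I) G Q \<iota> M \<mu>"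
    unfolding glued_up_def by blast
  have "top_cone_iso I G Q \<iota> M \<mu>"
    using iso family is_limit_Hom(1)[OF lim] cone_iso_eq_top_cone_iso[of I \<iota> G Q \<mu> M] by blast
  then obtain h k where "homeomorphic_maps M Q k h"
    "\<And>a x. a \<in> Ob (Gl I) \<Longrightarrow> x \<in> pts a \<Longrightarrow> k (\<mu> a x) = \<iota> a x"
    unfolding top_cone_iso_def by (metis homeomorphic_maps_sym)
  then have "glued_from Q (\<lambda>i. \<iota> (ob1 I i))"
    using is_limit_imp_glued_from[OF universe lim]
    by (intro glued_from_homeomorphic_maps[of M "\<lambda>i. \<mu> (ob1 I i)" Q k h]) (simp_all add: gl_ob)
  then show "pt_cocone \<iota> \<and> glued_from Q (\<lambda>i. \<iota> (ob1 I i))"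
    using g cone_over_iff_pt_cocone[OF family] by (simp add: glued_up_def)
next
  assume r: "pt_cocone \<iota> \<and> glued_from Q (\<lambda>i. \<iota> (ob1 I i))"
  then have lim: "is_limit (dual TopCat) (Gl I) G Q \<iota>"
    using family by (intro glued_from_imp_is_limit) auto
  have "top_cone_iso I G Q \<iota> Q \<iota>"
    unfolding top_cone_iso_def by (intro exI[of _ id]) (auto simp: homeomorphic_maps_id)
  then have "cone_iso (dual TopCat) (Gl I) G Q \<iota> Q \<iota>"
    using family cone_iso_eq_top_cone_iso[of I \<iota> G Q \<iota> Q] by blast
  then show "glued_up (dual TopCat) I G Q \<iota>"
    using lim unfolding glued_up_def is_limit_def by blast
qed

text \<open>Descent between \<open>Q\<close> and the standard representative, in both directions, gives mutually
  inverse maps; conversely the property of being glued is carried along the homeomorphism.\<close>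

lemma top_cone_iso_std_iff_glued_from:
  assumes \<iota>: "pt_cocone \<iota>"
  shows "top_cone_iso I G Q \<iota> (std_space I G) (std_inj I G) \<longleftrightarrow> glued_from Q (\<lambda>i. \<iota> (ob1 I i))"
proof
  assume "top_cone_iso I G Q \<iota> (std_space I G) (std_inj I G)"
  then obtain h k where hk: "homeomorphic_maps (std_space I G) Q k h"
    "\<And>a x. a \<in> Ob (Gl I) \<Longrightarrow> x \<in> pts a \<Longrightarrow> k (std_inj I G a x) = \<iota> a x"
    unfolding top_cone_iso_def by (metis homeomorphic_maps_sym)
  show "glued_from Q (\<lambda>i. \<iota> (ob1 I i))"
  proof (rule glued_from_homeomorphic_maps[OF glued_from_std_space hk(1)])
    show "k (glue_proj I G (x, i)) = \<iota> (ob1 I i) x" if "i \<in> I" "x \<in> pts (ob1 I i)" for i x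
      using hk(2)[OF gl_ob(1)[OF that(1)] that(2)] std_inj_ob1[OF functor_G that] by simp
  qed
next
  let ?S = "std_space I G" and ?pi = "\<lambda>i x. glue_proj I G (x, i)"
  assume Q: "glued_from Q (\<lambda>i. \<iota> (ob1 I i))"
  obtain h where h: "continuous_map Q ?S h"
    "\<And>i x. i \<in> I \<Longrightarrow> x \<in> pts (ob1 I i) \<Longrightarrow> h (\<iota> (ob1 I i) x) = ?pi i x"
    using glued_from_descent[OF Q, of ?S ?pi] glued_from_continuous[OF glued_from_std_space]
      glue_proj_eq_iff glue_rel_in by metis
  obtain k where k: "continuous_map ?S Q k"
    "\<And>i x. i \<in> I \<Longrightarrow> x \<in> pts (ob1 I i) \<Longrightarrow> k (?pi i x) = \<iota> (ob1 I i) x"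
    using glued_from_descent[OF glued_from_std_space, of Q "\<lambda>i. \<iota> (ob1 I i)"]
      glued_from_continuous[OF Q] pt_cocone_glue_rel[OF \<iota>] by metis
  have "k (h q) = q" if "q \<in> topspace Q" for q
    using glued_from_cover[OF Q that] h(2) k(2) by metis
  moreover have "h (k q) = q" if "q \<in> topspace ?S" for q
    using glued_from_cover[OF glued_from_std_space that] h(2) k(2) by metis
  ultimately have "homeomorphic_maps Q ?S h k"
    using h(1) k(1) by (simp add: homeomorphic_maps_def)
  moreover have "h (\<iota> a x) = std_inj I G a x \<and> k (std_inj I G a x) = \<iota> a x"
    if a: "a \<in> Ob (Gl I)" and x: "x \<in> pts a" for a x
    using h(2)[OF ob_first_in[OF a] garr_in[OF gl_arrow_from_first[OF a] x]]
      k(2)[OF ob_first_in[OF a] garr_in[OF gl_arrow_from_first[OF a] x]]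
    by (simp add: std_inj_def pt_cocone_first[OF \<iota> a x])
  ultimately show "top_cone_iso I G Q \<iota> ?S (std_inj I G)" unfolding top_cone_iso_def by blast
qed

section \<open>The characterization by maps and images\<close>

text \<open>Cocone equations compose, so it suffices to check them on the generating arrows.  The arrows
  \<open>[j,i] \<rightarrow> [i,j]\<close> are covered by the equations on \<open>G(i,j)\<close>, and those from \<open>[j,i,k]\<close> to \<open>[i,j,k]\<close>
  reduce to them because the components at \<open>[i,j,k]\<close> and \<open>[j,i,k]\<close> are the components at \<open>[i,j]\<close>
  and \<open>[j,i]\<close> after a projection.\<close>

lemma pt_cocone_iff_generators:
  "pt_cocone \<iota> \<longleftrightarrow>
    (\<forall>i\<in>I. \<forall>j\<in>I. \<forall>x\<in>pts (ob2 I i j).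
       \<iota> (ob2 I i j) x = \<iota> (ob1 I i) (garr G (ob1 I i) (ob2 I i j) x)) \<and>
    (\<forall>i\<in>I. \<forall>j\<in>I. \<forall>k\<in>I. \<forall>n\<in>{j, k}. \<forall>x\<in>pts (ob3 I i j k).
       \<iota> (ob3 I i j k) x = \<iota> (ob2 I i n) (garr G (ob2 I i n) (ob3 I i j k) x)) \<and>
    (\<forall>i\<in>I. \<forall>j\<in>I. \<forall>x\<in>pts (ob2 I i j).
       \<iota> (ob1 I i) (garr G (ob1 I i) (ob2 I i j) x) =
       \<iota> (ob1 I j) (garr G (ob1 I j) (ob2 I j i) (garr G (ob2 I j i) (ob2 I i j) x)))"
  (is "_ \<longleftrightarrow> ?a \<and> ?b \<and> ?c")
proof
  assume c: "pt_cocone \<iota>"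
  show "?a \<and> ?b \<and> ?c"
    using gl_arrow.eta2[of _ I]
    by (auto simp: pt_coconeD[OF c] garr_comp gl_arrow.eta1 gl_arrow.tau2 gl_arrow_snd)
next
  assume abc: "?a \<and> ?b \<and> ?c"
  then have a: ?a and b: ?b and c: ?c by blast+
  have tau: "\<iota> (ob2 I i j) x = \<iota> (ob2 I j i) (garr G (ob2 I j i) (ob2 I i j) x)"
    if "i \<in> I" "j \<in> I" "x \<in> pts (ob2 I i j)" for i j x
    using that a c garr_in[OF gl_arrow.tau2] by metis
  have "\<forall>x\<in>pts b. \<iota> b x = \<iota> a (garr G a b x)" if "gl_arrow I a b" for a b
    using that
  proof (induction rule: gl_arrow.induct)
    case (ide a)
    then have "a \<in> Ob (Gl I)" by (simp add: Gl_def)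
    then show ?case by (simp add: garr_ide)
  next
    case (eta1 i j)
    then show ?case using a by blast
  next
    case (tau2 i j)
    then show ?case using tau by blast
  next
    case (eta2 i j k n)
    then show ?case using b by blast
  next
    case (tau3 i j k)
    show ?case
    proof
      fix x assume x: "x \<in> pts (ob3 I i j k)"
      have e: "gl_arrow I (ob2 I i j) (ob3 I i j k)" "gl_arrow I (ob2 I j i) (ob3 I j i k)"
        "gl_arrow I (ob3 I j i k) (ob3 I i j k)" "gl_arrow I (ob2 I j i) (ob2 I i j)"
        using tau3 by (auto intro: gl_arrow.intros)
      have "\<iota> (ob3 I i j k) x = \<iota> (ob2 I i j) (garr G (ob2 I i j) (ob3 I i j k) x)"
        using b tau3 x by blast
      also have "\<dots> = \<iota> (ob2 I j i) (garr G (ob2 I j i) (ob3 I i j k) x)"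
        using tau[OF tau3(1,2) garr_in[OF e(1) x]] e x by (simp add: garr_comp)
      also have "\<dots> = \<iota> (ob2 I j i) (garr G (ob2 I j i) (ob3 I j i k) (garr G (ob3 I j i k) (ob3 I i j k) x))"
        using e x by (simp add: garr_comp)
      also have "\<dots> = \<iota> (ob3 I j i k) (garr G (ob3 I j i k) (ob3 I i j k) x)"
        using b tau3 garr_in[OF e(3) x] by force
      finally show "\<iota> (ob3 I i j k) x = \<iota> (ob3 I j i k) (garr G (ob3 I j i k) (ob3 I i j k) x)" .
    qed
  next
    case (comp a b c)
    then show ?case by (metis garr_comp garr_in)
  qed
  then show "pt_cocone \<iota>" unfolding pt_cocone_def by blast
qed

text \<open>If a point is hit from \<open>G(i)\<close> at \<open>x\<close> and from \<open>G(j)\<close> at \<open>y\<close>, the condition on images places it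
  over some \<open>u\<close> in \<open>G(i,j)\<close>; injectivity then identifies \<open>x\<close> and \<open>y\<close> with the projections of \<open>u\<close>,
  that is, \<open>u\<close> witnesses \<open>glue_rel\<close>.\<close>

lemma eq_iff_glue_rel_iff_images:
  assumes compat: "\<And>i j x y. ((x, i), (y, j)) \<in> glue_rel I G \<Longrightarrow> f i x = f j y"
  shows "(\<forall>i\<in>I. \<forall>j\<in>I. \<forall>x\<in>pts (ob1 I i). \<forall>y\<in>pts (ob1 I j).
        f i x = f j y \<longleftrightarrow> ((x, i), (y, j)) \<in> glue_rel I G) \<longleftrightarrow>
    (\<forall>i\<in>I. \<forall>j\<in>I.
       f j ` garr G (ob1 I j) (ob2 I j i) ` pts (ob2 I j i) =
         f i ` garr G (ob1 I i) (ob2 I i j) ` pts (ob2 I i j) \<and>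
       f i ` garr G (ob1 I i) (ob2 I i j) ` pts (ob2 I i j) =
         f i ` pts (ob1 I i) \<inter> f j ` pts (ob1 I j)) \<and>
    (\<forall>i\<in>I. inj_on (f i) (pts (ob1 I i)))"
  (is "?P \<longleftrightarrow> ?e \<and> ?f")
proof
  assume P: ?P
  have img: "f i ` garr G (ob1 I i) (ob2 I i j) ` pts (ob2 I i j) =
      f i ` pts (ob1 I i) \<inter> f j ` pts (ob1 I j)" if ij: "i \<in> I" "j \<in> I" for i j
  proof (intro equalityI subsetI)
    fix z assume "z \<in> f i ` garr G (ob1 I i) (ob2 I i j) ` pts (ob2 I i j)"
    then obtain u where u: "u \<in> pts (ob2 I i j)" "z = f i (garr G (ob1 I i) (ob2 I i j) u)" by blast
    note r = glue_relI[OF ij u(1)]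
    show "z \<in> f i ` pts (ob1 I i) \<inter> f j ` pts (ob1 I j)"
      unfolding u(2) using compat[OF r] glue_rel_in(3,4)[OF r] by (metis IntI imageI)
  next
    fix z assume "z \<in> f i ` pts (ob1 I i) \<inter> f j ` pts (ob1 I j)"
    then obtain x y where "x \<in> pts (ob1 I i)" "y \<in> pts (ob1 I j)" "z = f i x" "f i x = f j y" by auto
    then have "((x, i), (y, j)) \<in> glue_rel I G" "z = f i x" using P ij by blast+
    then show "z \<in> f i ` garr G (ob1 I i) (ob2 I i j) ` pts (ob2 I i j)" by (auto elim: glue_relE)
  qed
  have ?e using img by (simp add: Int_commute)
  moreover have ?f using P glue_rel_same_index unfolding inj_on_def by blast
  ultimately show "?e \<and> ?f" ..
next
  assume ef: "?e \<and> ?f"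
  have "((x, i), (y, j)) \<in> glue_rel I G"
    if ij: "i \<in> I" "j \<in> I" and x: "x \<in> pts (ob1 I i)" and y: "y \<in> pts (ob1 I j)"
      and eq: "f i x = f j y" for i j x y
  proof -
    have "f i x \<in> f i ` pts (ob1 I i) \<inter> f j ` pts (ob1 I j)"
      using x y eq by (metis IntI imageI)
    then have "f i x \<in> f i ` garr G (ob1 I i) (ob2 I i j) ` pts (ob2 I i j)"
      using ef ij by simp
    then obtain u where u: "u \<in> pts (ob2 I i j)" "f i x = f i (garr G (ob1 I i) (ob2 I i j) u)"
      by blast
    note r = glue_relI[OF ij u(1)]
    have "x = garr G (ob1 I i) (ob2 I i j) u" "y = garr G (ob1 I j) (ob2 I i j) u"
      using ef ij x y u(2) eq compat[OF r] glue_rel_in[OF r] unfolding inj_on_def by metis+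
    then show ?thesis using r by simp
  qed
  then show ?P using compat by blast
qed

end

theorem theorem2p6:
  fixes I :: "'i set"
    and G :: "('i gl_obj, unit, 'u topology, 'u \<Rightarrow> 'u) ftor"
    and Q :: "'u topology"
    and \<iota> :: "'i gl_obj \<Rightarrow> 'u \<Rightarrow> 'u"
  assumes universe: "\<exists>x y :: 'u. x \<noteq> y"
    and gluing: "gluing_data_functor (dual TopCat) I G"
    and family: "\<forall>a\<in>Ob (Gl I). \<iota> a \<in> Hom TopCat (OMap G a) Q"
  shows
    "(glued_up (dual TopCat) I G Q \<iota> \<longleftrightarrow>
        cone_over (dual TopCat) (Gl I) G Q \<iota> \<and>
        top_cone_iso I G Q \<iota> (std_space I G) (std_inj I G)) \<and>
     (glued_up (dual TopCat) I G Q \<iota> \<longleftrightarrow>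
        Q = final_topology (topspace Q) I (\<lambda>i. OMap G (ob1 I i)) (\<lambda>i. \<iota> (ob1 I i)) \<and>
        (\<forall>i\<in>I. \<forall>j\<in>I. \<iota> (ob2 I i j) =
           compose (topspace (OMap G (ob2 I i j))) (\<iota> (ob1 I i)) (garr G (ob1 I i) (ob2 I i j))) \<and>
        (\<forall>i\<in>I. \<forall>j\<in>I. \<forall>k\<in>I. \<forall>n\<in>{j, k}. \<iota> (ob3 I i j k) =
           compose (topspace (OMap G (ob3 I i j k))) (\<iota> (ob2 I i n)) (garr G (ob2 I i n) (ob3 I i j k))) \<and>
        (\<forall>i\<in>I. \<forall>j\<in>I.
           compose (topspace (OMap G (ob2 I i j))) (\<iota> (ob1 I i)) (garr G (ob1 I i) (ob2 I i j)) =
           compose (topspace (OMap G (ob2 I i j))) (\<iota> (ob1 I j))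
             (compose (topspace (OMap G (ob2 I i j))) (garr G (ob1 I j) (ob2 I j i))
               (garr G (ob2 I j i) (ob2 I i j)))) \<and>
        topspace Q = (\<Union>i\<in>I. \<iota> (ob1 I i) ` topspace (OMap G (ob1 I i))) \<and>
        (\<forall>i\<in>I. \<forall>j\<in>I.
           \<iota> (ob1 I j) ` garr G (ob1 I j) (ob2 I j i) ` topspace (OMap G (ob2 I j i)) =
             \<iota> (ob1 I i) ` garr G (ob1 I i) (ob2 I i j) ` topspace (OMap G (ob2 I i j)) \<and>
           \<iota> (ob1 I i) ` garr G (ob1 I i) (ob2 I i j) ` topspace (OMap G (ob2 I i j)) =
             \<iota> (ob1 I i) ` topspace (OMap G (ob1 I i)) \<inter> \<iota> (ob1 I j) ` topspace (OMap G (ob1 I j))) \<and>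
        (\<forall>i\<in>I. continuous_map (OMap G (ob1 I i)) Q (\<iota> (ob1 I i)) \<and>
           inj_on (\<iota> (ob1 I i)) (topspace (OMap G (ob1 I i)))))"
proof -
  interpret gluing_data I G using gluing by unfold_locales
  note up = glued_up_iff_glued_from[OF universe family]
  have "glued_up (dual TopCat) I G Q \<iota> \<longleftrightarrow>
      cone_over (dual TopCat) (Gl I) G Q \<iota> \<and> top_cone_iso I G Q \<iota> (std_space I G) (std_inj I G)"
    using up cone_over_iff_pt_cocone[OF family] top_cone_iso_std_iff_glued_from[of \<iota> Q] by blast
  moreover
  \<comment> \<open>equality of extensional functions is equality on the points of the source\<close>
  have ext: "\<iota> a = compose (pts a) g h \<longleftrightarrow> (\<forall>x\<in>pts a. \<iota> a x = g (h x))" if "a \<in> Ob (Gl I)" for a g h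
    using family that by (auto simp: TopCat_def compose_def restrict_def fun_eq_iff extensional_def)
  have cmp: "compose S g h = compose S g' (compose S h' k) \<longleftrightarrow> (\<forall>x\<in>S. g (h x) = g' (h' (k x)))"
    for S :: "'u set" and g h g' h' k
    by (auto simp: compose_def restrict_def fun_eq_iff)
  have cont: "\<forall>i\<in>I. continuous_map (OMap G (ob1 I i)) Q (\<iota> (ob1 I i))"
    using family gl_ob(1) by (fastforce simp: TopCat_def)
  have "pt_cocone \<iota> \<longleftrightarrow>
     (\<forall>i\<in>I. \<forall>j\<in>I. \<iota> (ob2 I i j) =
        compose (pts (ob2 I i j)) (\<iota> (ob1 I i)) (garr G (ob1 I i) (ob2 I i j))) \<and>
     (\<forall>i\<in>I. \<forall>j\<in>I. \<forall>k\<in>I. \<forall>n\<in>{j, k}. \<iota> (ob3 I i j k) =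
        compose (pts (ob3 I i j k)) (\<iota> (ob2 I i n)) (garr G (ob2 I i n) (ob3 I i j k))) \<and>
     (\<forall>i\<in>I. \<forall>j\<in>I.
        compose (pts (ob2 I i j)) (\<iota> (ob1 I i)) (garr G (ob1 I i) (ob2 I i j)) =
        compose (pts (ob2 I i j)) (\<iota> (ob1 I j))
          (compose (pts (ob2 I i j)) (garr G (ob1 I j) (ob2 I j i)) (garr G (ob2 I j i) (ob2 I i j))))"
    unfolding pt_cocone_iff_generators cmp by (simp add: ext gl_ob)
  moreover have "glued_from Q (\<lambda>i. \<iota> (ob1 I i)) \<longleftrightarrow>
     Q = final_topology (topspace Q) I (\<lambda>i. OMap G (ob1 I i)) (\<lambda>i. \<iota> (ob1 I i)) \<and>
     topspace Q = (\<Union>i\<in>I. \<iota> (ob1 I i) ` pts (ob1 I i)) \<and>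
     (\<forall>i\<in>I. \<forall>j\<in>I.
        \<iota> (ob1 I j) ` garr G (ob1 I j) (ob2 I j i) ` pts (ob2 I j i) =
          \<iota> (ob1 I i) ` garr G (ob1 I i) (ob2 I i j) ` pts (ob2 I i j) \<and>
        \<iota> (ob1 I i) ` garr G (ob1 I i) (ob2 I i j) ` pts (ob2 I i j) =
          \<iota> (ob1 I i) ` pts (ob1 I i) \<inter> \<iota> (ob1 I j) ` pts (ob1 I j)) \<and>
     (\<forall>i\<in>I. inj_on (\<iota> (ob1 I i)) (pts (ob1 I i)))" if "pt_cocone \<iota>"
    unfolding glued_from_def
    using eq_iff_glue_rel_iff_images[of "\<lambda>i. \<iota> (ob1 I i)"] pt_cocone_glue_rel[OF that] by simp
  ultimately show ?thesis using up cont by (simp only: ball_conj_distrib) argo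
qed

end
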